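(* Let $f$ be a standard operator monotone function and $A\in M_n(\mathbb C)$ self-adjoint. Then $\rho\mapsto \mathrm{qCov}^f_\rho(A,A)$ is a concave function on the set of positive definite density matrices $\rho\in M_n(\mathbb C)$.
   Context: A function $f:(0,\infty)\to(0,\infty)$ is standard operator monotone if it is operator monotone, $xf(x^{-1})=f(x)$ and $f(1)=1$. For positive definite $\rho$, $\mathbb L_\rho X=\rho X$, $\mathbb R_\rho X=X\rho$, $\mathbb J^f_\rho=f(\mathbb L_\rho\mathbb R_\rho^{-1})\mathbb R_\rho$ on $M_n(\mathbb C)$ with inner product $\langle B,C\rangle=\mathrm{Tr}\,B^*C$. The generalized covariance is $\mathrm{qCov}^f_\rho(A,B)=\langle A,\mathbb J^f_\rho B\rangle-(\mathrm{Tr}\,\rho A^* )(\mathrm{Tr}\,\rho B)$ (equivalently $\langle A\rho^{1/2},f(\Delta(\rho/\rho))(B\rho^{1/2})\rangle-(\mathrm{Tr}\,\rho A^* )(\mathrm{Tr}\,\rho B)$ with $\Delta(\rho/\rho)B=\rho B\rho^{-1}$). *)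

theory Defs
  imports "Jordan_Normal_Form.Matrix"
begin

definition cmat_adj :: "complex mat \<Rightarrow> complex mat" where
  "cmat_adj A = mat (dim_col A) (dim_row A) (\<lambda>(i,j). cnj (A $$ (j,i)))"

definition mtrace :: "complex mat \<Rightarrow> complex" where
  "mtrace A = (\<Sum>i<dim_row A. A $$ (i,i))"

definition hermitian_mat :: "nat \<Rightarrow> complex mat \<Rightarrow> bool" where
  "hermitian_mat n A \<longleftrightarrow> A \<in> carrier_mat n n \<and> cmat_adj A = A"

definition unitary_mat :: "nat \<Rightarrow> complex mat \<Rightarrow> bool" where
  "unitary_mat n U \<longleftrightarrow> U \<in> carrier_mat n n \<and> U * cmat_adj U = 1\<^sub>m n \<and> cmat_adj U * U = 1\<^sub>m n"

definition qform :: "complex mat \<Rightarrow> complex vec \<Rightarrow> complex" where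
  "qform A v = (\<Sum>i<dim_vec v. \<Sum>j<dim_vec v. cnj (v $ i) * A $$ (i,j) * v $ j)"

definition psd_mat :: "nat \<Rightarrow> complex mat \<Rightarrow> bool" where
  "psd_mat n A \<longleftrightarrow> hermitian_mat n A \<and> (\<forall>v\<in>carrier_vec n. 0 \<le> Re (qform A v))"

definition posdef_mat :: "nat \<Rightarrow> complex mat \<Rightarrow> bool" where
  "posdef_mat n A \<longleftrightarrow> hermitian_mat n A \<and> (\<forall>v\<in>carrier_vec n. v \<noteq> 0\<^sub>v n \<longrightarrow> 0 < Re (qform A v))"

definition pd_density :: "nat \<Rightarrow> complex mat \<Rightarrow> bool" where
  "pd_density n \<rho> \<longleftrightarrow> posdef_mat n \<rho> \<and> mtrace \<rho> = 1"

definition mat_fun :: "(real \<Rightarrow> real) \<Rightarrow> complex mat \<Rightarrow> complex mat" where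
  "mat_fun f A = (SOME M. \<exists>U lam. unitary_mat (dim_row A) U \<and>
      A = U * mat_diag (dim_row A) (\<lambda>i. complex_of_real (lam i)) * cmat_adj U \<and>
      M = U * mat_diag (dim_row A) (\<lambda>i. complex_of_real (f (lam i))) * cmat_adj U)"

definition operator_monotone_pos :: "(real \<Rightarrow> real) \<Rightarrow> bool" where
  "operator_monotone_pos f \<longleftrightarrow>
     (\<forall>m A B. posdef_mat m A \<and> posdef_mat m B \<and> psd_mat m (B - A) \<longrightarrow>
        psd_mat m (mat_fun f B - mat_fun f A))"

definition standard_op_monotone :: "(real \<Rightarrow> real) \<Rightarrow> bool" where
  "standard_op_monotone f \<longleftrightarrow> operator_monotone_pos f \<and> (\<forall>x>0. f x > 0) \<and>
     (\<forall>x>0. x * f (1 / x) = f x) \<and> f 1 = 1"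

section \<open>Superoperators on M_n(C) as n^2 x n^2 matrices w.r.t. the
  (Hilbert-Schmidt orthonormal) basis E_kl, indexed by k*n+l\<close>

definition matunit :: "nat \<Rightarrow> nat \<Rightarrow> nat \<Rightarrow> complex mat" where
  "matunit n k l = mat n n (\<lambda>(i,j). if i = k \<and> j = l then 1 else 0)"

definition sop_mat :: "nat \<Rightarrow> (complex mat \<Rightarrow> complex mat) \<Rightarrow> complex mat" where
  "sop_mat n T = mat (n*n) (n*n)
     (\<lambda>(p,q). (T (matunit n (q div n) (q mod n))) $$ (p div n, p mod n))"

definition vec_of_mat :: "nat \<Rightarrow> complex mat \<Rightarrow> complex vec" where
  "vec_of_mat n X = vec (n*n) (\<lambda>p. X $$ (p div n, p mod n))"

definition mat_of_vec :: "nat \<Rightarrow> complex vec \<Rightarrow> complex mat" where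
  "mat_of_vec n v = mat n n (\<lambda>(i,j). v $ (i*n+j))"

definition minv :: "nat \<Rightarrow> complex mat \<Rightarrow> complex mat" where
  "minv n \<rho> = (SOME B. B \<in> carrier_mat n n \<and> \<rho> * B = 1\<^sub>m n \<and> B * \<rho> = 1\<^sub>m n)"

definition Jf :: "(real \<Rightarrow> real) \<Rightarrow> complex mat \<Rightarrow> complex mat \<Rightarrow> complex mat" where
  "Jf f \<rho> X = (let n = dim_row \<rho>;
                  L = sop_mat n (\<lambda>Y. \<rho> * Y);
                  Rinv = sop_mat n (\<lambda>Y. Y * minv n \<rho>);
                  R = sop_mat n (\<lambda>Y. Y * \<rho>)
              in mat_of_vec n ((mat_fun f (L * Rinv) * R) *\<^sub>v vec_of_mat n X))"

definition hs_inner :: "complex mat \<Rightarrow> complex mat \<Rightarrow> complex" where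
  "hs_inner B C = mtrace (cmat_adj B * C)"

definition qCov :: "(real \<Rightarrow> real) \<Rightarrow> complex mat \<Rightarrow> complex mat \<Rightarrow> complex mat \<Rightarrow> complex" where
  "qCov f \<rho> A B = hs_inner A (Jf f \<rho> B) - mtrace (\<rho> * cmat_adj A) * mtrace (\<rho> * B)"

end

theory Submission
  imports Defs "Jordan_Normal_Form.Spectral_Radius"
begin

text \<open>The term \<open>(Tr \<rho> A)\<^sup>2\<close> is the square of a real linear function of \<open>\<rho>\<close>, so it suffices that
  \<open>\<rho> \<mapsto> \<langle>A, f(L R\<^sup>-\<^sup>1) R A\<rangle>\<close> is concave, where \<open>L\<close> and \<open>R\<close> are left and right multiplication by \<open>\<rho>\<close>.
  Both depend linearly on \<open>\<rho>\<close>, so this is joint concavity of the perspective of \<open>f\<close> on commuting pairs.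
  If \<open>L = \<Sum> s\<^sub>i L\<^sub>i\<close> and \<open>R = \<Sum> s\<^sub>i R\<^sub>i\<close>, then \<open>W = ((s\<^sub>i R\<^sub>i)\<^sup>1\<^sup>/\<^sup>2 R\<^sup>-\<^sup>1\<^sup>/\<^sup>2)\<^sub>i\<close> is an isometry with
  \<open>W\<^sup>* (\<Oplus> L\<^sub>i R\<^sub>i\<^sup>-\<^sup>1) W = L R\<^sup>-\<^sup>1\<close>, and concavity follows from the compression inequality
  \<open>W\<^sup>* f(D) W \<le> f(W\<^sup>* D W)\<close>, which Hansen's block matrix argument derives from operator monotonicity.\<close>

section \<open>Adjoints and quadratic forms\<close>

text \<open>The matrices \<open>\<rho>1\<close>, \<open>\<rho>2\<close> and their mixture need not
  commute, so three unrelated eigenbases are in play. What does commute is L with R for one and the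
  same \<open>\<rho>\<close>: in a joint eigenbasis f(L R^-1) R is diagonal, its quadratic form is a
  weighted sum of squares (\<open>wnorm\<close>), and square roots are taken of numbers only. The
  same commutation gives R_i^(1/2) (L_i R_i^-1) R_i^(1/2) = L_i, so the compression by W is R^(-1/2)
  (sum of s_i L_i) R^(-1/2) = L R^-1. The compression inequality is tested on c = R^(1/2) x, where x
  is A written as a vector: W c is then the column of the (s_i R_i)^(1/2) x, and the two sides of
  the inequality become the two sides of the concavity claim. The weights s_i enter W but not the
  direct sum, which stays positive when some s_i is 0, so the end points need no separate
  case.\<close>

lemma mat_carrier_iff: "A \<in> carrier_mat n m \<longleftrightarrow> dim_row A = n \<and> dim_col A = m"
  by auto

lemma cmat_adj_dim [simp]: "dim_row (cmat_adj A) = dim_col A" "dim_col (cmat_adj A) = dim_row A"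
  by (simp_all add: cmat_adj_def)

lemma cmat_adj_carrier [simp]: "A \<in> carrier_mat n m \<Longrightarrow> cmat_adj A \<in> carrier_mat m n"
  by (simp add: mat_carrier_iff del: carrier_matD)

lemma cmat_adj_index [simp]:
  "i < dim_col A \<Longrightarrow> j < dim_row A \<Longrightarrow> cmat_adj A $$ (i, j) = cnj (A $$ (j, i))"
  by (simp add: cmat_adj_def)

lemma mat_diag_dims [simp]: "dim_row (mat_diag n f) = n" "dim_col (mat_diag n f) = n"
  by (simp_all add: mat_diag_def)

lemma cmat_adj_adj [simp]: "cmat_adj (cmat_adj A) = A"
  by (rule eq_matI) auto

lemma mat_mult_index: "i < dim_row A \<Longrightarrow> j < dim_col B \<Longrightarrow> dim_col A = dim_row B \<Longrightarrow>
    (A * B) $$ (i, j) = (\<Sum>k<dim_row B. A $$ (i, k) * B $$ (k, j))"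
  by (simp add: scalar_prod_def atLeast0LessThan)

lemma mat_mult_vec_index: "i < dim_row A \<Longrightarrow> dim_col A = dim_vec v \<Longrightarrow>
    (A *\<^sub>v v) $ i = (\<Sum>k<dim_vec v. A $$ (i, k) * v $ k)"
  by (simp add: scalar_prod_def atLeast0LessThan)

lemma cmat_adj_mult: "dim_col A = dim_row B \<Longrightarrow> cmat_adj (A * B) = cmat_adj B * cmat_adj A"
  by (rule eq_matI) (auto simp: mat_mult_index mult.commute simp del: index_mult_mat(1))

lemma cmat_adj_add: "dim_row A = dim_row B \<Longrightarrow> dim_col A = dim_col B \<Longrightarrow>
    cmat_adj (A + B) = cmat_adj A + cmat_adj B"
  by (rule eq_matI) auto

lemma cmat_adj_minus: "dim_row A = dim_row B \<Longrightarrow> dim_col A = dim_col B \<Longrightarrow>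
    cmat_adj (A - B) = cmat_adj A - cmat_adj B"
  by (rule eq_matI) auto

lemma cmat_adj_smult: "cmat_adj (k \<cdot>\<^sub>m A) = cnj k \<cdot>\<^sub>m cmat_adj A"
  by (rule eq_matI) auto

lemma cmat_adj_one [simp]: "cmat_adj (1\<^sub>m n) = 1\<^sub>m n"
  by (rule eq_matI) auto

lemma cmat_adj_diag [simp]: "cmat_adj (mat_diag n (\<lambda>i. complex_of_real (d i))) = mat_diag n (\<lambda>i. of_real (d i))"
  by (rule eq_matI) (auto simp: mat_diag_def)

lemma mat_assoc: "dim_col A = dim_row B \<Longrightarrow> dim_col B = dim_row C \<Longrightarrow> A * B * C = A * (B * C)"
  for A B C :: "complex mat"
  by (rule assoc_mult_mat[of _ "dim_row A" "dim_col A" _ "dim_col B" _ "dim_col C"]) auto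

lemma mat_vec_assoc: "dim_col A = dim_row B \<Longrightarrow> dim_col B = dim_vec v \<Longrightarrow> (A * B) *\<^sub>v v = A *\<^sub>v (B *\<^sub>v v)"
  for A B :: "complex mat"
  by (rule assoc_mult_mat_vec[of _ "dim_row A" "dim_col A" _ "dim_col B"]) auto

lemma mat_add_mult: "dim_row A = dim_row B \<Longrightarrow> dim_col A = dim_col B \<Longrightarrow> dim_col B = dim_row C \<Longrightarrow>
    (A + B) * C = A * C + B * C" for A B C :: "complex mat"
  by (rule add_mult_distrib_mat[of _ "dim_row A" "dim_col A" _ _ "dim_col C"]) auto

lemma mat_mult_add: "dim_col A = dim_row B \<Longrightarrow> dim_row B = dim_row C \<Longrightarrow> dim_col B = dim_col C \<Longrightarrow>
    A * (B + C) = A * B + A * C" for A B C :: "complex mat"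
  by (rule mult_add_distrib_mat[of _ "dim_row A" "dim_col A" _ "dim_col B"]) auto

lemma mat_one_left [simp]: "dim_row A = n \<Longrightarrow> 1\<^sub>m n * A = A" for A :: "complex mat"
  by (rule left_mult_one_mat[of _ _ "dim_col A"]) auto

lemma mat_one_right [simp]: "dim_col A = n \<Longrightarrow> A * 1\<^sub>m n = A" for A :: "complex mat"
  by (rule right_mult_one_mat[of _ "dim_row A"]) auto

lemma mat_one_vec [simp]: "dim_vec v = n \<Longrightarrow> 1\<^sub>m n *\<^sub>v v = v" for v :: "complex vec"
  by (rule one_mult_mat_vec) (rule carrier_vecI)

text \<open>With all products associated to the right, an adjacent pair occurs as U (U^* X); hence
  the versions with a trailing matrix or vector.\<close>

lemma unitary_cancel:
  assumes "unitary_mat n U"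
  shows "dim_row U = n" "dim_col U = n" "U * cmat_adj U = 1\<^sub>m n" "cmat_adj U * U = 1\<^sub>m n"
    "dim_row X = n \<Longrightarrow> U * (cmat_adj U * X) = X" "dim_row X = n \<Longrightarrow> cmat_adj U * (U * X) = X"
    "dim_vec v = n \<Longrightarrow> U *\<^sub>v (cmat_adj U *\<^sub>v v) = v" "dim_vec v = n \<Longrightarrow> cmat_adj U *\<^sub>v (U *\<^sub>v v) = v"
proof -
  show d: "dim_row U = n" "dim_col U = n" "U * cmat_adj U = 1\<^sub>m n" "cmat_adj U * U = 1\<^sub>m n"
    using assms by (auto simp: unitary_mat_def)
  show "U * (cmat_adj U * X) = X" "cmat_adj U * (U * X) = X" if "dim_row X = n"
    using that mat_assoc[of U "cmat_adj U" X] mat_assoc[of "cmat_adj U" U X] d by simp_all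
  show "U *\<^sub>v (cmat_adj U *\<^sub>v v) = v" "cmat_adj U *\<^sub>v (U *\<^sub>v v) = v" if "dim_vec v = n"
    using that mat_vec_assoc[of U "cmat_adj U" v] mat_vec_assoc[of "cmat_adj U" U v] d by simp_all
qed

lemma unitary_mult:
  assumes "unitary_mat n U" "unitary_mat n V"
  shows "unitary_mat n (U * V)"
  using assms unitary_cancel[OF assms(1)] unitary_cancel[OF assms(2)]
  by (auto simp: unitary_mat_def cmat_adj_mult mat_assoc mat_carrier_iff simp del: carrier_matD)

definition cinner :: "complex vec \<Rightarrow> complex vec \<Rightarrow> complex" where
  "cinner u v = (\<Sum>i<dim_vec v. cnj (u $ i) * v $ i)"

lemma cinner_mult_left:
  assumes "dim_col X = dim_vec u" "dim_row X = dim_vec v"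
  shows "cinner (X *\<^sub>v u) v = cinner u (cmat_adj X *\<^sub>v v)"
proof -
  have "cinner (X *\<^sub>v u) v = (\<Sum>i<dim_vec v. \<Sum>k<dim_vec u. cnj (X $$ (i,k)) * cnj (u $ k) * v $ i)"
    using assms by (simp add: cinner_def mat_mult_vec_index sum_distrib_right del: index_mult_mat_vec)
  also have "\<dots> = (\<Sum>k<dim_vec u. \<Sum>i<dim_vec v. cnj (X $$ (i,k)) * cnj (u $ k) * v $ i)"
    by (rule sum.swap)
  also have "\<dots> = cinner u (cmat_adj X *\<^sub>v v)"
    using assms by (simp add: cinner_def mat_mult_vec_index sum_distrib_left mult_ac del: index_mult_mat_vec)
  finally show ?thesis .
qed

lemma qform_cinner: "A \<in> carrier_mat (dim_vec v) (dim_vec v) \<Longrightarrow> qform A v = cinner v (A *\<^sub>v v)"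
  by (simp add: qform_def cinner_def mat_mult_vec_index sum_distrib_left mult.assoc del: index_mult_mat_vec)

lemma qform_congruence:
  assumes "A \<in> carrier_mat n n" "dim_row X = n" "dim_col X = dim_vec v"
  shows "qform (cmat_adj X * A * X) v = qform A (X *\<^sub>v v)"
  using assms by (simp add: qform_cinner cinner_mult_left mat_assoc mat_vec_assoc mat_carrier_iff del: carrier_matD)

lemma qform_add: "A \<in> carrier_mat (dim_vec v) (dim_vec v) \<Longrightarrow> B \<in> carrier_mat (dim_vec v) (dim_vec v) \<Longrightarrow>
    qform (A + B) v = qform A v + qform B v"
  by (simp add: qform_def sum.distrib algebra_simps)

lemma qform_minus: "A \<in> carrier_mat (dim_vec v) (dim_vec v) \<Longrightarrow> B \<in> carrier_mat (dim_vec v) (dim_vec v) \<Longrightarrow>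
    qform (A - B) v = qform A v - qform B v"
  by (simp add: qform_def sum_subtractf algebra_simps)

lemma qform_smult: "A \<in> carrier_mat (dim_vec v) (dim_vec v) \<Longrightarrow> qform (k \<cdot>\<^sub>m A) v = k * qform A v"
  by (simp add: qform_def sum_distrib_left mult_ac)

text \<open>The quadratic form of a real diagonal matrix, as a real number. After passage to an
  eigenbasis every form in the proof is of this kind, and matrix inequalities become inequalities
  between such sums.\<close>

definition wnorm :: "(nat \<Rightarrow> real) \<Rightarrow> complex vec \<Rightarrow> real" where
  "wnorm d v = (\<Sum>i<dim_vec v. d i * (cmod (v $ i))\<^sup>2)"

lemma qform_diag:
  assumes "dim_vec v = n"
  shows "qform (mat_diag n (\<lambda>i. complex_of_real (d i))) v = complex_of_real (wnorm d v)"
proof -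
  have *: "(\<Sum>j<n. cnj (v $ i) * mat_diag n (\<lambda>i. complex_of_real (d i)) $$ (i, j) * v $ j)
      = of_real (d i * (cmod (v $ i))\<^sup>2)" if "i < n" for i
  proof -
    have "(\<Sum>j<n. cnj (v $ i) * mat_diag n (\<lambda>i. complex_of_real (d i)) $$ (i, j) * v $ j)
      = (\<Sum>j<n. if i = j then cnj (v $ i) * of_real (d j) * v $ j else 0)"
      using that by (intro sum.cong) (auto simp: mat_diag_def)
    also have "\<dots> = of_real (d i) * (v $ i * cnj (v $ i))"
      using that by simp
    finally show ?thesis by (simp add: complex_norm_square del: of_real_power)
  qed
  show ?thesis using assms * by (simp add: qform_def wnorm_def)
qed

lemma qform_one: "dim_vec v = n \<Longrightarrow> qform (1\<^sub>m n) v = complex_of_real (wnorm (\<lambda>_. 1) v)"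
  using qform_diag[of v n "\<lambda>_. 1"] by simp

lemma qform_spectral:
  assumes "dim_row U = n" "dim_col U = m" "dim_vec v = n"
  shows "qform (U * mat_diag m (\<lambda>i. complex_of_real (d i)) * cmat_adj U) v = of_real (wnorm d (cmat_adj U *\<^sub>v v))"
  using assms qform_congruence[of "mat_diag m (\<lambda>i. complex_of_real (d i))" m "cmat_adj U" v]
  by (simp add: qform_diag)

lemma hermitian_spectral:
  assumes "U \<in> carrier_mat n m"
  shows "hermitian_mat n (U * mat_diag m (\<lambda>i. complex_of_real (d i)) * cmat_adj U)"
  using assms by (simp add: hermitian_mat_def cmat_adj_mult mat_assoc mat_carrier_iff del: carrier_matD)

lemma hermitian_congruence:
  assumes "hermitian_mat n A" "U \<in> carrier_mat n m"
  shows "hermitian_mat m (cmat_adj U * A * U)"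
  using assms by (simp add: hermitian_mat_def cmat_adj_mult mat_assoc mat_carrier_iff del: carrier_matD)

section \<open>The spectral theorem\<close>

lemma mat_unit_vec_col: "A \<in> carrier_mat n m \<Longrightarrow> j < m \<Longrightarrow> A *\<^sub>v unit_vec m j = col A j"
  for A :: "complex mat"
  by (rule eq_vecI) auto

text \<open>Gram-Schmidt, applied to a basis that starts with \<open>v\<close>, leaves
  \<open>v\<close> unchanged and makes the vectors orthogonal but not normalised. Dividing by the
  norms, the square roots of \<open>r\<close>, gives the columns of \<open>U\<close>.\<close>

lemma unitary_with_first_column:
  assumes v: "v \<in> carrier_vec n" and v0: "v \<noteq> 0\<^sub>v n"
  obtains U k where "unitary_mat n U" "col U 0 = k \<cdot>\<^sub>v v"
proof -
  interpret cof_vec_space n "TYPE(complex)" .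
  note b = basis_completion[OF v v0]
  define ws where "ws = gram_schmidt n (basis_completion v)"
  note gs = gram_schmidt_result[OF b(2) b(4) b(5) ws_def]
  have n: "n > 0" using v v0 by (cases n) auto
  have len: "length ws = n" using gs(4) b(6) by simp
  obtain vs where bv: "basis_completion v = v # vs"
    using b(6,7) n by (cases "basis_completion v") auto
  have ws0: "ws ! 0 = v" using gram_schmidt_hd[OF v, of vs] len n 
    by (metis bv hd_conv_nth length_0_conv less_irrefl ws_def)
  define r where "r j = Re (ws ! j \<bullet>c ws ! j)" for j
  define U where "U = mat n n (\<lambda>(i,j). complex_of_real (1 / sqrt (r j)) * ws ! j $ i)"
  have wd: "ws ! j \<in> carrier_vec n" if "j < n" for j using gs(3) len that by (metis nth_mem subset_iff)
  have sp: "ws ! j \<bullet>c ws ! i = (\<Sum>k<n. ws ! j $ k * cnj (ws ! i $ k))" if "i < n" "j < n" for i j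
    using wd[OF that(1)] wd[OF that(2)] by (simp add: scalar_prod_def atLeast0LessThan)
  have rr: "ws ! j \<bullet>c ws ! j = of_real (r j)" "r j > 0" if "j < n" for j
  proof -
    define q where "q = (\<Sum>k<n. (cmod (ws ! j $ k))\<^sup>2)"
    have "ws ! j \<bullet>c ws ! j = of_real q"
      unfolding sp[OF that that] q_def by (simp add: complex_norm_square del: of_real_power)
    moreover have "0 \<le> q" by (simp add: q_def sum_nonneg)
    moreover have "ws ! j \<bullet>c ws ! j \<noteq> 0" using corthogonalD[OF gs(2)] len that by auto
    ultimately show "ws ! j \<bullet>c ws ! j = of_real (r j)" "r j > 0" by (auto simp: r_def)
  qed
  have Uc: "U \<in> carrier_mat n n" by (simp add: U_def)
  have UU: "cmat_adj U * U = 1\<^sub>m n"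
  proof (rule eq_matI)
    fix i j assume ij: "i < dim_row (1\<^sub>m n :: complex mat)" "j < dim_col (1\<^sub>m n :: complex mat)"
    hence "(cmat_adj U * U) $$ (i,j) = (\<Sum>k<n. cnj (U $$ (k,i)) * U $$ (k,j))"
      using Uc by (simp add: mat_mult_index del: index_mult_mat(1))
    also have "\<dots> = of_real (1 / sqrt (r i)) * of_real (1 / sqrt (r j)) * (ws ! j \<bullet>c ws ! i)"
      using ij by (simp add: sp U_def sum_distrib_left mult_ac)
    also have "\<dots> = 1\<^sub>m n $$ (i,j)"
    proof (cases "i = j")
      case True
      have "of_real (1 / sqrt (r i)) * of_real (1 / sqrt (r j)) * (ws ! j \<bullet>c ws ! i)
          = complex_of_real (1 / sqrt (r i) * (1 / sqrt (r i)) * r i)"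
        unfolding of_real_mult using rr(1)[of i] ij True by simp
      also have "1 / sqrt (r i) * (1 / sqrt (r i)) * r i = 1" using rr(2)[of i] ij by simp
      finally show ?thesis using True ij by simp
    next
      case False
      hence "ws ! j \<bullet>c ws ! i = 0" using corthogonalD[OF gs(2), of j i] ij len by auto
      then show ?thesis using False ij by simp
    qed
    finally show "(cmat_adj U * U) $$ (i,j) = 1\<^sub>m n $$ (i,j)" .
  qed (use Uc in auto)
  have "U * cmat_adj U = 1\<^sub>m n"
    using mat_mult_left_right_inverse[OF _ Uc UU] Uc by simp
  hence "unitary_mat n U" using Uc UU by (simp add: unitary_mat_def)
  moreover have "col U 0 = complex_of_real (1 / sqrt (r 0)) \<cdot>\<^sub>v v"
    using n v ws0 by (intro eq_vecI) (auto simp: U_def)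
  ultimately show ?thesis by (rule that)
qed

lemma complex_eigenvector_exists:
  assumes "A \<in> carrier_mat n n" "n > 0"
  obtains v e where "v \<in> carrier_vec n" "v \<noteq> 0\<^sub>v n" "A *\<^sub>v v = e \<cdot>\<^sub>v (v :: complex vec)"
proof -
  obtain e where "eigenvalue A e" using spectrum_non_empty[OF assms] by (auto simp: spectrum_def)
  then show ?thesis using that assms by (auto simp: eigenvalue_def eigenvector_def)
qed

lemma cmat_adj_four_block:
  assumes "A \<in> carrier_mat a a" "D \<in> carrier_mat b b" "B \<in> carrier_mat a b" "C \<in> carrier_mat b a"
  shows "cmat_adj (four_block_mat A B C D)
    = four_block_mat (cmat_adj A) (cmat_adj C) (cmat_adj B) (cmat_adj D)"
  using assms by (intro eq_matI) auto

text \<open>Deflation: in an orthonormal basis whose first vector is an eigenvector, the first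
  column vanishes below the corner. Hermitian symmetry makes the first row vanish as well, and the
  remaining block is Hermitian of size one less.\<close>

theorem spectral_theorem:
  assumes "hermitian_mat n A"
  shows "\<exists>U lam. unitary_mat n U \<and> A = U * mat_diag n (\<lambda>i. complex_of_real (lam i)) * cmat_adj U"
  using assms
proof (induction n arbitrary: A)
  case 0
  then show ?case
    by (intro exI[of _ "1\<^sub>m 0"] exI[of _ "\<lambda>_. 0"]) (auto simp: unitary_mat_def hermitian_mat_def intro!: eq_matI)
next
  case (Suc n)
  let ?N = "Suc n"
  have A: "A \<in> carrier_mat ?N ?N" using Suc.prems by (simp add: hermitian_mat_def)
  obtain v e where v: "v \<in> carrier_vec ?N" "v \<noteq> 0\<^sub>v ?N" "A *\<^sub>v v = e \<cdot>\<^sub>v v"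
    using complex_eigenvector_exists[OF A] by auto
  obtain W k where W: "unitary_mat ?N W" and col: "col W 0 = k \<cdot>\<^sub>v v"
    using unitary_with_first_column[OF v(1,2)] .
  note Wc = unitary_cancel[OF W]
  define B where "B = cmat_adj W * A * W"
  have hB: "hermitian_mat ?N B"
    unfolding B_def by (rule hermitian_congruence[OF Suc.prems]) (use Wc in auto)
  have Bc: "B \<in> carrier_mat ?N ?N" using hB by (simp add: hermitian_mat_def)
  have W0: "W *\<^sub>v unit_vec ?N 0 = k \<cdot>\<^sub>v v"
    using col mat_unit_vec_col[of W ?N ?N 0] Wc by (auto intro: carrier_matI)
  have "B *\<^sub>v unit_vec ?N 0 = cmat_adj W *\<^sub>v (A *\<^sub>v (k \<cdot>\<^sub>v v))"
    unfolding B_def using Wc A W0 by (simp add: mat_assoc mat_vec_assoc)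
  also have "A *\<^sub>v (k \<cdot>\<^sub>v v) = e \<cdot>\<^sub>v (W *\<^sub>v unit_vec ?N 0)"
    using mult_mat_vec[OF A v(1), of k] v(3) W0 by (simp add: smult_smult_assoc mult.commute)
  also have "cmat_adj W *\<^sub>v (e \<cdot>\<^sub>v (W *\<^sub>v unit_vec ?N 0)) = e \<cdot>\<^sub>v (cmat_adj W *\<^sub>v (W *\<^sub>v unit_vec ?N 0))"
    by (rule mult_mat_vec[of _ ?N ?N]) (use Wc in \<open>auto intro: carrier_matI carrier_vecI\<close>)
  also have "\<dots> = e \<cdot>\<^sub>v unit_vec ?N 0" using Wc by simp
  finally have col0: "col B 0 = e \<cdot>\<^sub>v unit_vec ?N 0"
    using mat_unit_vec_col[of B ?N ?N 0] Bc by simp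
  have Bi0: "B $$ (i, 0) = (if i = 0 then e else 0)" if "i < ?N" for i
    using arg_cong[OF col0, of "\<lambda>v. v $ i"] that Bc by (simp add: unit_vec_def)
  have sym: "B $$ (i, j) = cnj (B $$ (j, i))" if "i < ?N" "j < ?N" for i j
    using hB that cmat_adj_index[of i B j] by (auto simp: hermitian_mat_def)
  have B0i: "B $$ (0, i) = (if i = 0 then e else 0)" if "i < ?N" for i
    using sym[of 0 i] Bi0[OF that] Bi0[of 0] sym[of 0 0] that by (auto split: if_splits)
  \<comment> \<open>The eigenvalue was taken from the complex spectrum; as a diagonal entry of a
    Hermitian matrix it is real, as the statement requires.\<close>
  have "cnj e = e" using sym[of 0 0] Bi0[of 0] by simp
  then obtain x where e: "e = complex_of_real x" by (metis Reals_cnj_iff Reals_cases)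
  define C where "C = mat n n (\<lambda>(i,j). B $$ (Suc i, Suc j))"
  have hC: "hermitian_mat n C"
    unfolding hermitian_mat_def C_def
    by (auto intro!: eq_matI simp: sym[symmetric])
  obtain U lam where U: "unitary_mat n U"
    and C: "C = U * mat_diag n (\<lambda>i. complex_of_real (lam i)) * cmat_adj U"
    using Suc.IH[OF hC] by auto
  note Uc = unitary_cancel[OF U]
  have Ucm: "U \<in> carrier_mat n n" using Uc by auto
  define V where "V = four_block_mat (1\<^sub>m 1) (0\<^sub>m 1 n) (0\<^sub>m n 1) U"
  have adjV: "cmat_adj V = four_block_mat (1\<^sub>m 1) (0\<^sub>m 1 n) (0\<^sub>m n 1) (cmat_adj U)"
    unfolding V_def using Ucm
    by (subst cmat_adj_four_block[where a=1 and b=n]) (auto intro!: arg_cong2[where f="\<lambda>a b. four_block_mat _ a b _"] eq_matI)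
  define mu where "mu i = (case i of 0 \<Rightarrow> x | Suc j \<Rightarrow> lam j)" for i
  have Bblk: "B = four_block_mat (e \<cdot>\<^sub>m 1\<^sub>m 1) (0\<^sub>m 1 n) (0\<^sub>m n 1) C"
  proof (rule eq_matI)
    fix i j assume "i < dim_row (four_block_mat (e \<cdot>\<^sub>m 1\<^sub>m 1) (0\<^sub>m 1 n) (0\<^sub>m n 1) C)"
      "j < dim_col (four_block_mat (e \<cdot>\<^sub>m 1\<^sub>m 1) (0\<^sub>m 1 n) (0\<^sub>m n 1) C)"
    hence ij: "i < ?N" "j < ?N" by (auto simp: C_def)
    show "B $$ (i,j) = four_block_mat (e \<cdot>\<^sub>m 1\<^sub>m 1) (0\<^sub>m 1 n) (0\<^sub>m n 1) C $$ (i,j)"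
      using ij Bi0[OF ij(1)] B0i[OF ij(2)]
      by (cases i; cases j) (auto simp: C_def)
  qed (use Bc in \<open>auto simp: C_def\<close>)
  have Dblk: "mat_diag ?N (\<lambda>i. complex_of_real (mu i)) =
      four_block_mat (e \<cdot>\<^sub>m 1\<^sub>m 1) (0\<^sub>m 1 n) (0\<^sub>m n 1) (mat_diag n (\<lambda>i. complex_of_real (lam i)))"
  proof (rule eq_matI, goal_cases)
    case (1 i j)
    then show ?case
      by (cases i; cases j) (auto simp: mat_diag_def mu_def e)
  qed auto
  have "C \<in> carrier_mat n n" by (simp add: C_def)
  \<comment> \<open>The zero summand is the product of the two off-diagonal blocks, which appears in
    the lower right corner of the block product.\<close>
  hence z: "0\<^sub>m n n + U * mat_diag n (\<lambda>i. complex_of_real (lam i)) * cmat_adj U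
      = U * mat_diag n (\<lambda>i. complex_of_real (lam i)) * cmat_adj U"
    unfolding C[symmetric] by simp
  have Bsp: "B = V * mat_diag ?N (\<lambda>i. complex_of_real (mu i)) * cmat_adj V"
    unfolding Dblk adjV unfolding V_def
    using Ucm
    by (subst mult_four_block_mat[where ?nr1.0=1 and ?n1.0=1 and ?n2.0=n and ?nr2.0=n and ?nc1.0=1 and ?nc2.0=n], simp_all)
      (subst mult_four_block_mat[where ?nr1.0=1 and ?n1.0=1 and ?n2.0=n and ?nr2.0=n and ?nc1.0=1 and ?nc2.0=n],
        simp_all add: Bblk C z)
  have one: "four_block_mat (1\<^sub>m 1) (0\<^sub>m 1 n) (0\<^sub>m n 1) (1\<^sub>m n) = (1\<^sub>m ?N :: complex mat)"
    by (rule eq_matI) auto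
  have V: "unitary_mat ?N V"
    unfolding unitary_mat_def adjV unfolding V_def
    using Ucm Uc
    by (auto simp: mult_four_block_mat[where ?nr1.0=1 and ?n1.0=1 and ?n2.0=n and ?nr2.0=n and ?nc1.0=1 and ?nc2.0=n] one)
  have "A = W * B * cmat_adj W"
    unfolding B_def using Wc A by (simp add: mat_assoc)
  also have "\<dots> = (W * V) * mat_diag ?N (\<lambda>i. complex_of_real (mu i)) * cmat_adj (W * V)"
    unfolding Bsp using Wc unitary_cancel[OF V] by (simp add: mat_assoc cmat_adj_mult)
  finally show ?case using unitary_mult[OF W V] by blast
qed

section \<open>Functional calculus\<close>

text \<open>Entrywise, a_i G_ij = G_ij b_j, so wherever G_ij is nonzero a_i = b_j and hence f(a_i) =
  f(b_j). This works for an arbitrary function f, without polynomial approximation.\<close>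

lemma diag_intertwine:
  assumes G: "G \<in> carrier_mat n m"
    and eq: "mat_diag n (\<lambda>i. complex_of_real (a i)) * G = G * mat_diag m (\<lambda>i. complex_of_real (b i))"
  shows "mat_diag n (\<lambda>i. complex_of_real (f (a i))) * G = G * mat_diag m (\<lambda>i. complex_of_real (f (b i)))"
proof -
  have "complex_of_real (f (a i)) * G $$ (i,j) = G $$ (i,j) * complex_of_real (f (b j))"
    if ij: "i < n" "j < m" for i j
  proof -
    have "complex_of_real (a i) * G $$ (i,j) = G $$ (i,j) * complex_of_real (b j)"
      using arg_cong[OF eq, of "\<lambda>M. M $$ (i,j)"] ij
      by (simp add: mat_diag_mult_left[OF G] mat_diag_mult_right[OF G])
    then show ?thesis by (cases "G $$ (i,j) = 0") auto
  qed
  then show ?thesis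
    by (intro eq_matI) (auto simp: mat_diag_mult_left[OF G] mat_diag_mult_right[OF G])
qed

lemma spectral_intertwine:
  assumes U: "unitary_mat n U" and W: "dim_row W = n" "dim_col W = m"
    and eq: "U * mat_diag n (\<lambda>i. complex_of_real (a i)) * cmat_adj U * W = W * mat_diag m (\<lambda>i. complex_of_real (b i))"
  shows "U * mat_diag n (\<lambda>i. complex_of_real (f (a i))) * cmat_adj U * W = W * mat_diag m (\<lambda>i. complex_of_real (f (b i)))"
proof -
  note Uc = unitary_cancel[OF U]
  have "mat_diag n (\<lambda>i. complex_of_real (a i)) * (cmat_adj U * W)
      = cmat_adj U * (U * mat_diag n (\<lambda>i. complex_of_real (a i)) * cmat_adj U * W)"
    using Uc W by (simp add: mat_assoc)
  also have "\<dots> = (cmat_adj U * W) * mat_diag m (\<lambda>i. complex_of_real (b i))"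
    unfolding eq using Uc W by (simp add: mat_assoc)
  finally have "mat_diag n (\<lambda>i. complex_of_real (f (a i))) * (cmat_adj U * W)
      = (cmat_adj U * W) * mat_diag m (\<lambda>i. complex_of_real (f (b i)))"
    by (rule diag_intertwine[rotated]) (use Uc W in auto)
  from arg_cong[OF this, of "\<lambda>X. U * X"] show ?thesis
    using Uc W by (simp add: mat_assoc)
qed

text \<open>The value does not depend on the decomposition chosen by \<open>mat_fun\<close>: any two
  unitary diagonalisations of \<open>A\<close> are intertwined by \<open>A\<close> itself, and
  intertwining passes from eigenvalues to their images under f.\<close>

lemma mat_fun_spectral:
  assumes U: "unitary_mat n U" and A: "A = U * mat_diag n (\<lambda>i. complex_of_real (lam i)) * cmat_adj U"
  shows "mat_fun f A = U * mat_diag n (\<lambda>i. complex_of_real (f (lam i))) * cmat_adj U"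
proof -
  note Uc = unitary_cancel[OF U]
  have dA: "dim_row A = n" using A Uc by simp
  let ?P = "\<lambda>M. \<exists>U lam. unitary_mat (dim_row A) U \<and>
      A = U * mat_diag (dim_row A) (\<lambda>i. complex_of_real (lam i)) * cmat_adj U \<and>
      M = U * mat_diag (dim_row A) (\<lambda>i. complex_of_real (f (lam i))) * cmat_adj U"
  have "\<exists>M. ?P M" unfolding dA using U A by blast
  hence "?P (mat_fun f A)" unfolding mat_fun_def by (rule someI_ex)
  then obtain V mu where V: "unitary_mat n V"
    and AV: "A = V * mat_diag n (\<lambda>i. complex_of_real (mu i)) * cmat_adj V"
    and M: "mat_fun f A = V * mat_diag n (\<lambda>i. complex_of_real (f (mu i))) * cmat_adj V"
    unfolding dA by blast
  note Vc = unitary_cancel[OF V]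
  have "V * mat_diag n (\<lambda>i. complex_of_real (mu i)) * cmat_adj V * U = U * mat_diag n (\<lambda>i. complex_of_real (lam i))"
    unfolding AV[symmetric] unfolding A using Uc by (simp add: mat_assoc)
  from spectral_intertwine[OF V _ _ this, of f]
  have "mat_fun f A * U = U * mat_diag n (\<lambda>i. complex_of_real (f (lam i)))"
    unfolding M using Uc by simp
  from arg_cong[OF this, of "\<lambda>X. X * cmat_adj U"] show ?thesis
    using Uc Vc unfolding M by (simp add: mat_assoc)
qed

lemma mat_fun_carrier:
  assumes "hermitian_mat n B"
  shows "mat_fun f B \<in> carrier_mat n n"
proof -
  obtain U lam where U: "unitary_mat n U" and B: "B = U * mat_diag n (\<lambda>i. complex_of_real (lam i)) * cmat_adj U"
    using spectral_theorem[OF assms] by blast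
  show ?thesis unfolding mat_fun_spectral[OF U B] using unitary_cancel[OF U] by auto
qed

text \<open>\<open>W\<close> may be rectangular: its columns satisfy the eigenvector equation of
  \<open>B\<close>, and f acts on their span without knowledge of \<open>B\<close>
  elsewhere.\<close>

lemma mat_fun_intertwine:
  assumes B: "hermitian_mat n B" and W: "W \<in> carrier_mat n m"
    and eq: "B * W = W * mat_diag m (\<lambda>i. complex_of_real (mu i))"
  shows "mat_fun f B * W = W * mat_diag m (\<lambda>i. complex_of_real (f (mu i)))"
proof -
  obtain U lam where U: "unitary_mat n U" and B: "B = U * mat_diag n (\<lambda>i. complex_of_real (lam i)) * cmat_adj U"
    using spectral_theorem[OF B] by blast
  show ?thesis unfolding mat_fun_spectral[OF U B]
    by (rule spectral_intertwine[OF U]) (use W eq B in auto)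
qed

lemma unitary_one [simp]: "unitary_mat n (1\<^sub>m n)"
  by (simp add: unitary_mat_def)

lemma mat_fun_diag: "mat_fun f (mat_diag n (\<lambda>i. complex_of_real (d i))) = mat_diag n (\<lambda>i. complex_of_real (f (d i)))"
  using mat_fun_spectral[OF unitary_one, of "mat_diag n (\<lambda>i. complex_of_real (d i))" n d f] by simp

section \<open>Weighted norms\<close>

lemma wnorm_nonneg: "(\<And>i. i < dim_vec v \<Longrightarrow> 0 \<le> d i) \<Longrightarrow> 0 \<le> wnorm d v"
  unfolding wnorm_def by (intro sum_nonneg mult_nonneg_nonneg) auto

lemma wnorm_pos:
  assumes d: "\<And>i. i < n \<Longrightarrow> 0 < d i" and v: "dim_vec v = n" "v \<noteq> 0\<^sub>v n"
  shows "0 < wnorm d v"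
proof -
  obtain i where i: "i < n" "v $ i \<noteq> 0" using v by (metis eq_vecI index_zero_vec)
  show ?thesis unfolding wnorm_def
    by (rule sum_pos2[of _ i]) (use i v d in \<open>auto simp: less_imp_le\<close>)
qed

lemma wnorm_unit_vec: "j < n \<Longrightarrow> wnorm d (unit_vec n j) = d j"
proof -
  assume j: "j < n"
  have "wnorm d (unit_vec n j) = (\<Sum>i<n. if i = j then d j else 0)"
    unfolding wnorm_def using j by (intro sum.cong) auto
  then show ?thesis using j by simp
qed

lemma isometry_unit_vec_nonzero:
  assumes W: "dim_col W = m" and WW: "cmat_adj W * W = 1\<^sub>m m" and j: "j < m"
  shows "W *\<^sub>v unit_vec m j \<noteq> 0\<^sub>v (dim_row W)"
proof
  assume *: "W *\<^sub>v unit_vec m j = 0\<^sub>v (dim_row W)"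
  have "unit_vec m j = cmat_adj W *\<^sub>v (W *\<^sub>v unit_vec m j)"
    using mat_vec_assoc[of "cmat_adj W" W "unit_vec m j"] W WW by simp
  also have "\<dots> = 0\<^sub>v m"
    unfolding * using W by (intro eq_vecI) (auto simp: mat_mult_vec_index simp del: index_mult_mat_vec(1))
  finally show False using j by (metis index_unit_vec(1) index_zero_vec(1) zero_neq_one)
qed

lemma wnorm_mono: "(\<And>i. i < dim_vec v \<Longrightarrow> d i \<le> d' i) \<Longrightarrow> wnorm d v \<le> wnorm d' v"
  unfolding wnorm_def by (intro sum_mono mult_right_mono) auto

lemma wnorm_scale: "wnorm (\<lambda>i. k * d i) v = k * wnorm d v"
  by (simp add: wnorm_def sum_distrib_left mult_ac)

lemma wnorm_shift: "wnorm (\<lambda>i. d i - k) v = wnorm d v - k * wnorm (\<lambda>_. 1) v"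
  by (simp add: wnorm_def sum_distrib_left sum_subtractf algebra_simps)

text \<open>The cross term is absorbed by 2xy \<le> e x^2 + y^2/e. The asymmetry is intended: the
  first summand pays a factor close to 1, and the large factor falls on the second.\<close>

lemma cmod_add_square_le:
  assumes "e > 0"
  shows "(cmod (a + b))\<^sup>2 \<le> (1 + e) * (cmod a)\<^sup>2 + (1 + 1/e) * (cmod b)\<^sup>2"
proof -
  let ?x = "cmod a" and ?y = "cmod b"
  have "(cmod (a + b))\<^sup>2 \<le> (?x + ?y)\<^sup>2" by (intro power_mono norm_triangle_ineq) auto
  moreover have "0 \<le> (sqrt e * ?x - ?y / sqrt e)\<^sup>2" by simp
  moreover have "(sqrt e * ?x - ?y / sqrt e)\<^sup>2 = e * ?x\<^sup>2 + ?y\<^sup>2 / e - 2 * ?x * ?y"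
    using assms by (simp add: power2_diff power_mult_distrib power_divide)
  ultimately show ?thesis by (simp add: power2_sum algebra_simps)
qed

lemma wnorm_add_le:
  assumes "e > 0" "\<And>i. i < n \<Longrightarrow> 0 \<le> d i" "dim_vec a = n" "dim_vec b = n"
  shows "wnorm d (a + b) \<le> (1 + e) * wnorm d a + (1 + 1/e) * wnorm d b"
proof -
  have "wnorm d (a + b) \<le> (\<Sum>i<n. d i * ((1 + e) * (cmod (a $ i))\<^sup>2 + (1 + 1/e) * (cmod (b $ i))\<^sup>2))"
    unfolding wnorm_def using assms by (auto intro!: sum_mono mult_left_mono cmod_add_square_le)
  also have "\<dots> = (1 + e) * wnorm d a + (1 + 1/e) * wnorm d b"
    unfolding wnorm_def using assms(3,4)
    by (simp only: sum_distrib_left sum.distrib[symmetric]) (rule sum.cong, auto simp: algebra_simps)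
  finally show ?thesis .
qed

lemma wnorm_le_sum:
  assumes "\<And>i. i < n \<Longrightarrow> 0 \<le> d i" "dim_vec v = n"
  shows "wnorm d v \<le> (\<Sum>i<n. d i) * wnorm (\<lambda>_. 1) v"
  using assms unfolding wnorm_scale[symmetric]
  by (intro wnorm_mono) (auto intro!: member_le_sum)

lemma wnorm_one_cinner: "complex_of_real (wnorm (\<lambda>_. 1) v) = cinner v v"
  by (simp add: wnorm_def cinner_def complex_norm_square mult.commute del: of_real_power)

lemma cinner_diff_right: "dim_vec a = dim_vec b \<Longrightarrow> cinner u (a - b) = cinner u a - cinner u b"
  by (simp add: cinner_def sum_subtractf algebra_simps)

lemma cinner_diff_left:
  "dim_vec a = dim_vec v \<Longrightarrow> dim_vec b = dim_vec v \<Longrightarrow> cinner (a - b) v = cinner a v - cinner b v"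
  by (simp add: cinner_def sum_subtractf algebra_simps)

text \<open>Pythagoras: W W^* is the orthogonal projection onto the range of \<open>W\<close>, and
  \<open>c\<close> has the same norm as its image under \<open>W\<close>.\<close>

lemma isometry_residual:
  assumes W: "dim_row W = dim_vec u" and WW: "cmat_adj W * W = 1\<^sub>m (dim_col W)"
  defines "c \<equiv> cmat_adj W *\<^sub>v u"
  shows "wnorm (\<lambda>_. 1) (u - W *\<^sub>v c) = wnorm (\<lambda>_. 1) u - wnorm (\<lambda>_. 1) c"
proof -
  have dc: "dim_vec c = dim_col W" by (simp add: c_def)
  have "cmat_adj W *\<^sub>v (W *\<^sub>v c) = c"
    using mat_vec_assoc[of "cmat_adj W" W c] WW dc by simp
  moreover have "cinner u (W *\<^sub>v c) = cinner c c"
    using cinner_mult_left[of "cmat_adj W" u c] W dc by (simp add: c_def)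
  ultimately have "cinner (u - W *\<^sub>v c) (u - W *\<^sub>v c) = cinner u u - cinner c c"
    using W dc by (simp add: cinner_diff_left cinner_diff_right cinner_mult_left flip: c_def)
  then show ?thesis
    unfolding wnorm_one_cinner[symmetric] by (simp flip: of_real_diff)
qed

section \<open>Compression inequality\<close>

lemma hermitian_diag: "hermitian_mat n (mat_diag n (\<lambda>i. complex_of_real (d i)))"
  by (simp add: hermitian_mat_def)

lemma posdef_diag: "(\<And>i. i < n \<Longrightarrow> 0 < d i) \<Longrightarrow> posdef_mat n (mat_diag n (\<lambda>i. complex_of_real (d i)))"
  by (auto simp: posdef_mat_def hermitian_diag qform_diag intro!: wnorm_pos[of n])

lemma hermitian_minus: "hermitian_mat n A \<Longrightarrow> hermitian_mat n B \<Longrightarrow> hermitian_mat n (A - B)"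
  by (auto simp: hermitian_mat_def cmat_adj_minus)

lemma hermitian_add: "hermitian_mat n A \<Longrightarrow> hermitian_mat n B \<Longrightarrow> hermitian_mat n (A + B)"
  by (auto simp: hermitian_mat_def cmat_adj_add)

lemma hermitian_smult: "hermitian_mat n A \<Longrightarrow> hermitian_mat n (complex_of_real k \<cdot>\<^sub>m A)"
  by (auto simp: hermitian_mat_def cmat_adj_smult)

text \<open>Operator monotonicity for matrices of size one.\<close>

lemma standard_op_monotone_mono:
  assumes f: "standard_op_monotone f" and xy: "0 < x" "x \<le> y"
  shows "f x \<le> f y"
proof -
  let ?D = "\<lambda>x :: real. mat_diag (Suc 0) (\<lambda>i. complex_of_real x)"
  have q: "qform (?D b - ?D a) v = of_real (wnorm (\<lambda>_. b) v) - of_real (wnorm (\<lambda>_. a) v)"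
    if "v \<in> carrier_vec (Suc 0)" for a b v
    using that by (simp add: qform_minus qform_diag[where d="\<lambda>_. a"] qform_diag[where d="\<lambda>_. b"])
  have "psd_mat (Suc 0) (?D y - ?D x)"
    unfolding psd_mat_def using xy
    by (auto simp: q hermitian_minus hermitian_diag[where d="\<lambda>_. x"] hermitian_diag[where d="\<lambda>_. y"] intro!: wnorm_mono)
  hence "psd_mat (Suc 0) (mat_fun f (?D y) - mat_fun f (?D x))"
    using f xy posdef_diag[of "Suc 0" "\<lambda>_. x"] posdef_diag[of "Suc 0" "\<lambda>_. y"]
    unfolding standard_op_monotone_def operator_monotone_pos_def by auto
  hence "0 \<le> Re (qform (?D (f y) - ?D (f x)) (unit_vec (Suc 0) 0))"
    unfolding mat_fun_diag[of f "Suc 0" "\<lambda>_. y"] mat_fun_diag[of f "Suc 0" "\<lambda>_. x"] psd_mat_def by auto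
  then show ?thesis by (simp add: q wnorm_def)
qed

text \<open>By the symmetry, f(x)/x = f(1/x), which is nonincreasing in x because f is
  nondecreasing.\<close>

lemma standard_op_monotone_scale:
  assumes f: "standard_op_monotone f" and "0 < x" "0 \<le> e"
  shows "f ((1 + e) * x) \<le> (1 + e) * f x"
proof -
  have sym: "x * f (1 / x) = f x" if "x > 0" for x
    using f that by (auto simp: standard_op_monotone_def)
  have le: "x \<le> (1 + e) * x" using assms by (simp add: algebra_simps)
  hence pos: "0 < (1 + e) * x" using assms by linarith
  have "1 / ((1 + e) * x) \<le> 1 / x" using le pos assms by (intro divide_left_mono) auto
  hence mono: "f (1 / ((1 + e) * x)) \<le> f (1 / x)"
    using pos by (intro standard_op_monotone_mono[OF f]) auto
  have "f ((1 + e) * x) = (1 + e) * x * f (1 / ((1 + e) * x))"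
    using sym[OF pos] by simp
  also have "\<dots> \<le> (1 + e) * x * f (1 / x)"
    using mono pos by (intro mult_left_mono) auto
  also have "\<dots> = (1 + e) * f x" using sym[of x] assms by simp
  finally show ?thesis .
qed

text \<open>Hansen's argument: the diagonal matrix \<open>D\<close> is dominated by a matrix \<open>B\<close> that is
  block diagonal with respect to the range of the isometry \<open>W\<close>, agrees with \<open>(1 + e) W\<^sup>* D W\<close> there
  and is a large scalar \<open>K\<close> on the complement. The symmetry of \<open>f\<close> gives
  \<open>f ((1 + e) x) \<le> (1 + e) f x\<close>, so that \<open>e\<close> tends to \<open>0\<close> without any continuity of \<open>f\<close>.\<close>

lemma compression_inequality:
  assumes f: "standard_op_monotone f" and W: "W \<in> carrier_mat N M"
    and d: "\<And>i. i < N \<Longrightarrow> 0 < d i"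
    and WW: "cmat_adj W * W = 1\<^sub>m M"
    and WDW: "cmat_adj W * mat_diag N (\<lambda>i. complex_of_real (d i)) * W = mat_diag M (\<lambda>i. complex_of_real (mu i))"
    and c: "dim_vec c = M"
  shows "wnorm (\<lambda>i. f (d i)) (W *\<^sub>v c) \<le> wnorm (\<lambda>i. f (mu i)) c"
proof -
  have Wd: "dim_row W = N" "dim_col W = M" using W by auto
  have Wmu: "wnorm d (W *\<^sub>v c) = wnorm mu c" if "dim_vec c = M" for c
  proof -
    have "complex_of_real (wnorm d (W *\<^sub>v c)) = qform (mat_diag N (\<lambda>i. complex_of_real (d i))) (W *\<^sub>v c)"
      using Wd by (simp add: qform_diag)
    also have "\<dots> = qform (mat_diag M (\<lambda>i. complex_of_real (mu i))) c"
      unfolding WDW[symmetric] using Wd that by (intro qform_congruence[symmetric]) auto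
    also have "\<dots> = of_real (wnorm mu c)" using that by (simp add: qform_diag)
    finally show ?thesis by simp
  qed
  \<comment> \<open>\<open>mu p\<close> is the form of the diagonal matrix at the nonzero vector W
    e_p. Positivity keeps every argument of f inside the half-line where f is controlled.\<close>
  have mu: "mu p > 0" if p: "p < M" for p
  proof -
    have "0 < wnorm d (W *\<^sub>v unit_vec M p)"
      using isometry_unit_vec_nonzero[OF Wd(2) WW p] Wd d by (intro wnorm_pos[of N]) auto
    also have "\<dots> = mu p" using Wmu[of "unit_vec M p"] wnorm_unit_vec[OF p] by simp
    finally show ?thesis .
  qed
  have fpos: "f x > 0" if "x > 0" for x using f that by (auto simp: standard_op_monotone_def)
  have "wnorm (\<lambda>i. f (d i)) (W *\<^sub>v c) \<le> (1 + e) * wnorm (\<lambda>i. f (mu i)) c" if e: "e > 0" for e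
  proof -
    \<comment> \<open>The factor that the part of a vector orthogonal to the range of
      \<open>W\<close> picks up: 1 + 1/e from splitting the square, and the sum of the weights as a
      bound for the largest of them.\<close>
    define K where "K = (1 + 1/e) * (\<Sum>i<N. d i)"
    define D where "D = mat_diag N (\<lambda>i. complex_of_real (d i))"
    define B where "B = W * mat_diag M (\<lambda>i. complex_of_real ((1 + e) * mu i - K)) * cmat_adj W
      + complex_of_real K \<cdot>\<^sub>m 1\<^sub>m N"
    have hB: "hermitian_mat N B"
      unfolding B_def using hermitian_diag[of N "\<lambda>_. 1"] W
      by (intro hermitian_add hermitian_spectral hermitian_smult) auto
    have hD: "hermitian_mat N D" by (simp add: D_def hermitian_diag)
    have Bc: "B \<in> carrier_mat N N" "D \<in> carrier_mat N N" using hB hD by (auto simp: hermitian_mat_def)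
    have qB: "qform B u = of_real ((1 + e) * wnorm mu (cmat_adj W *\<^sub>v u)
        + K * (wnorm (\<lambda>_. 1) u - wnorm (\<lambda>_. 1) (cmat_adj W *\<^sub>v u)))" if u: "dim_vec u = N" for u
    proof -
      have "qform (W * mat_diag M (\<lambda>i. complex_of_real ((1 + e) * mu i - K)) * cmat_adj W) u
          = of_real ((1 + e) * wnorm mu (cmat_adj W *\<^sub>v u) - K * wnorm (\<lambda>_. 1) (cmat_adj W *\<^sub>v u))"
        using qform_spectral[of W N M u "\<lambda>i. (1 + e) * mu i - K"] Wd u
        by (simp only: wnorm_shift wnorm_scale)
      moreover have "qform B u = qform (W * mat_diag M (\<lambda>i. complex_of_real ((1 + e) * mu i - K)) * cmat_adj W) u
          + K * qform (1\<^sub>m N) u"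
        unfolding B_def using Wd u by (subst qform_add) (auto simp: qform_smult)
      ultimately show ?thesis using u by (simp add: qform_one algebra_simps)
    qed
    have le: "wnorm d u \<le> Re (qform B u)" if u: "dim_vec u = N" for u
    proof -
      \<comment> \<open>\<open>a\<close> holds the coordinates of the projection of \<open>u\<close>
        to the range of \<open>W\<close>, and \<open>r\<close> is orthogonal to that range. The
        factors 1 + e and 1 + 1/e pay for the cross terms of \<open>D\<close> between the
        two.\<close>
      define a where "a = cmat_adj W *\<^sub>v u"
      define r where "r = u - W *\<^sub>v a"
      have da: "dim_vec a = M" "dim_vec r = N" by (auto simp: a_def r_def Wd)
      have "wnorm d u = wnorm d (W *\<^sub>v a + r)"
        by (rule arg_cong[where f="wnorm d"]) (rule eq_vecI, auto simp: r_def Wd u)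
      also have "\<dots> \<le> (1 + e) * wnorm d (W *\<^sub>v a) + (1 + 1/e) * wnorm d r"
        by (rule wnorm_add_le[of e N]) (use e d da Wd in \<open>auto simp: less_imp_le\<close>)
      also have "wnorm d (W *\<^sub>v a) = wnorm mu a" by (rule Wmu) (rule da)
      also have "(1 + 1/e) * wnorm d r \<le> (1 + 1/e) * ((\<Sum>i<N. d i) * wnorm (\<lambda>_. 1) r)"
        using e d da by (intro mult_left_mono wnorm_le_sum) (auto simp: less_imp_le)
      also have "\<dots> = K * wnorm (\<lambda>_. 1) r" by (simp add: K_def)
      also have "wnorm (\<lambda>_. 1) r = wnorm (\<lambda>_. 1) u - wnorm (\<lambda>_. 1) a"
        unfolding r_def a_def by (rule isometry_residual) (use Wd WW u in auto)
      finally show ?thesis using qB[OF u] by (simp add: a_def)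
    qed
    have pD: "posdef_mat N D" unfolding D_def by (rule posdef_diag) (rule d)
    have pB: "posdef_mat N B"
      unfolding posdef_mat_def
    proof (intro conjI ballI impI)
      fix v :: "complex vec" assume v: "v \<in> carrier_vec N" "v \<noteq> 0\<^sub>v N"
      hence "0 < wnorm d v" using d by (intro wnorm_pos[of N]) auto
      also have "\<dots> \<le> Re (qform B v)" using v by (intro le) auto
      finally show "0 < Re (qform B v)" .
    qed (rule hB)
    have "psd_mat N (B - D)"
      unfolding psd_mat_def using hB hD le Bc
      by (auto simp: hermitian_minus qform_minus) (simp add: D_def qform_diag)
    hence "psd_mat N (mat_fun f B - mat_fun f D)"
      using f pB pD unfolding standard_op_monotone_def operator_monotone_pos_def by blast
    hence "0 \<le> Re (qform (mat_fun f B - mat_fun f D) (W *\<^sub>v c))"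
      using carrier_vecI[of "W *\<^sub>v c" N] Wd unfolding psd_mat_def by simp
    hence 1: "wnorm (\<lambda>i. f (d i)) (W *\<^sub>v c) \<le> Re (qform (mat_fun f B) (W *\<^sub>v c))"
      using Wd mat_fun_carrier[OF hB, of f] by (simp add: D_def mat_fun_diag qform_minus qform_diag)
    define E where "E = mat_diag M (\<lambda>i. complex_of_real ((1 + e) * mu i - K))"
    have Ed: "dim_row E = M" "dim_col E = M" by (simp_all add: E_def)
    \<comment> \<open>The columns of \<open>W\<close> are eigenvectors of \<open>B\<close> with
      eigenvalues (1 + e) mu, so the compression of f(B) by \<open>W\<close> is explicit and
      contains no f(K).\<close>
    have "B * W = W * E * cmat_adj W * W + complex_of_real K \<cdot>\<^sub>m 1\<^sub>m N * W"
      unfolding B_def E_def[symmetric] by (rule add_mult_distrib_mat[of _ N N _ _ M]) (use Wd Ed in auto)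
    also have "complex_of_real K \<cdot>\<^sub>m 1\<^sub>m N * W = complex_of_real K \<cdot>\<^sub>m W"
      using mult_smult_assoc_mat[of "1\<^sub>m N" N N W M] W by simp
    also have "W * E * cmat_adj W * W = W * E * (cmat_adj W * W)"
      using Wd Ed by (simp add: mat_assoc)
    also have "W * E * (cmat_adj W * W) + complex_of_real K \<cdot>\<^sub>m W = W * mat_diag M (\<lambda>i. complex_of_real ((1 + e) * mu i))"
      unfolding WW E_def using Wd
      by (intro eq_matI) (auto simp: mat_diag_mult_right[OF W] algebra_simps)
    finally have "mat_fun f B * W = W * mat_diag M (\<lambda>i. complex_of_real (f ((1 + e) * mu i)))"
      by (rule mat_fun_intertwine[OF hB W])
    hence "cmat_adj W * mat_fun f B * W = mat_diag M (\<lambda>i. complex_of_real (f ((1 + e) * mu i)))"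
      using Wd WW mat_fun_carrier[OF hB, of f]
        mat_assoc[of "cmat_adj W" W "mat_diag M (\<lambda>i. complex_of_real (f ((1 + e) * mu i)))"]
      by (simp add: mat_assoc[of "cmat_adj W" "mat_fun f B" W])
    hence "qform (mat_fun f B) (W *\<^sub>v c) = of_real (wnorm (\<lambda>i. f ((1 + e) * mu i)) c)"
      using qform_congruence[OF mat_fun_carrier[OF hB, of f], of W c] Wd c by (simp add: qform_diag)
    hence "wnorm (\<lambda>i. f (d i)) (W *\<^sub>v c) \<le> wnorm (\<lambda>i. f ((1 + e) * mu i)) c" using 1 by simp
    also have "\<dots> \<le> wnorm (\<lambda>i. (1 + e) * f (mu i)) c"
      using e mu c by (intro wnorm_mono standard_op_monotone_scale[OF f]) auto
    finally show ?thesis by (simp add: wnorm_scale)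
  qed
  note bound = this
  have nn: "0 \<le> wnorm (\<lambda>i. f (mu i)) c" using fpos mu c by (intro wnorm_nonneg) (auto simp: less_imp_le)
  show ?thesis
  proof (rule field_le_epsilon)
    fix e :: real assume e: "e > 0"
    let ?Y = "wnorm (\<lambda>i. f (mu i)) c"
    \<comment> \<open>The denominator \<open>?Y + 1\<close> keeps this choice of the parameter
      legitimate when \<open>?Y\<close> is 0, and the excess is still at most e.\<close>
    have "wnorm (\<lambda>i. f (d i)) (W *\<^sub>v c) \<le> (1 + e / (?Y + 1)) * ?Y"
      using e nn by (intro bound) (auto intro: divide_pos_pos)
    also have "\<dots> = ?Y + e * (?Y / (?Y + 1))" by (simp add: algebra_simps)
    also have "\<dots> \<le> ?Y + e * 1" using e nn by (intro add_left_mono mult_left_mono) (auto simp: field_simps)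
    finally show "wnorm (\<lambda>i. f (d i)) (W *\<^sub>v c) \<le> ?Y + e" by simp
  qed
qed

section \<open>Joint concavity of the perspective\<close>

lemma mat_diag_real_cong:
  "(\<And>i. i < n \<Longrightarrow> g i = h i) \<Longrightarrow>
    mat_diag n (\<lambda>i. complex_of_real (g i)) = mat_diag n (\<lambda>i. complex_of_real (h i))"
  by (rule eq_matI) (auto simp: mat_diag_def)

lemma mat_diag_vec_index [simp]:
  "dim_vec y = m \<Longrightarrow> i < m \<Longrightarrow> (mat_diag m h *\<^sub>v y) $ i = h i * (y $ i :: complex)"
proof -
  assume a: "dim_vec y = m" "i < m"
  have "(mat_diag m h *\<^sub>v y) $ i = (\<Sum>k<m. mat_diag m h $$ (i, k) * y $ k)"
    using a by (subst mat_mult_vec_index) auto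
  also have "\<dots> = (\<Sum>k<m. if i = k then h k * y $ k else 0)"
    using a by (intro sum.cong) (auto simp: mat_diag_def)
  finally have "(mat_diag m h *\<^sub>v y) $ i = (\<Sum>k<m. if i = k then h k * y $ k else 0)" .
  then show ?thesis using a by simp
qed

lemma wnorm_diag_scale:
  assumes "dim_vec y = m" "\<And>i. i < m \<Longrightarrow> 0 \<le> k i"
  shows "wnorm g (mat_diag m (\<lambda>i. complex_of_real (sqrt (k i))) *\<^sub>v y) = wnorm (\<lambda>i. g i * k i) y"
  using assms by (auto simp: wnorm_def norm_mult power_mult_distrib simp del: index_mult_mat_vec(1) intro!: sum.cong)

section \<open>Columns of two operators and diagonal direct sums\<close>

lemma adj_diag_mult_index:
  assumes "X \<in> carrier_mat n m" "i < m" "j < m"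
  shows "(cmat_adj X * mat_diag n h * X) $$ (i, j) = (\<Sum>k<n. cnj (X $$ (k, i)) * h k * X $$ (k, j))"
proof -
  have X: "cmat_adj X \<in> carrier_mat m n" using assms by simp
  show ?thesis
    unfolding mat_diag_mult_right[OF X] using assms
    by (subst mat_mult_index) (auto intro!: sum.cong)
qed

lemma sum_lessThan_add: "(\<Sum>k<m + l. g k) = (\<Sum>k<m. g k) + (\<Sum>k<l. g (m + k))"
  for g :: "nat \<Rightarrow> 'a :: comm_monoid_add"
  by (induction l) (auto simp: add.assoc)

definition stack_rows :: "nat \<Rightarrow> complex mat \<Rightarrow> complex mat \<Rightarrow> complex mat" where
  "stack_rows m S T = mat (m + m) m (\<lambda>(i, j). if i < m then S $$ (i, j) else T $$ (i - m, j))"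

text \<open>Each summand of the direct sum is written in its own eigenbasis, so the sum is diagonal
  and concatenating the weights describes it.\<close>

definition stack_fun :: "nat \<Rightarrow> (nat \<Rightarrow> 'a) \<Rightarrow> (nat \<Rightarrow> 'a) \<Rightarrow> nat \<Rightarrow> 'a" where
  "stack_fun m a b i = (if i < m then a i else b (i - m))"

lemma stack_rows_carrier [simp]: "stack_rows m S T \<in> carrier_mat (m + m) m"
  by (simp add: stack_rows_def)

lemma stack_rows_congruence:
  assumes "S \<in> carrier_mat m m" "T \<in> carrier_mat m m"
  shows "cmat_adj (stack_rows m S T) * mat_diag (m + m) (\<lambda>i. complex_of_real (stack_fun m a b i)) * stack_rows m S T
    = cmat_adj S * mat_diag m (\<lambda>i. complex_of_real (a i)) * S + cmat_adj T * mat_diag m (\<lambda>i. complex_of_real (b i)) * T"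
    (is "?l = ?r")
proof (rule eq_matI)
  fix i j assume "i < dim_row ?r" "j < dim_col ?r"
  hence ij: "i < m" "j < m" using assms by auto
  have "?r $$ (i,j) = (cmat_adj S * mat_diag m (\<lambda>i. complex_of_real (a i)) * S) $$ (i,j)
      + (cmat_adj T * mat_diag m (\<lambda>i. complex_of_real (b i)) * T) $$ (i,j)"
    using ij assms by (intro index_add_mat(1)) auto
  then show "?l $$ (i,j) = ?r $$ (i,j)"
    unfolding adj_diag_mult_index[OF stack_rows_carrier ij] adj_diag_mult_index[OF assms(1) ij]
      adj_diag_mult_index[OF assms(2) ij] sum_lessThan_add
    using ij by (auto simp: stack_rows_def stack_fun_def)
qed (use assms in \<open>auto simp: stack_rows_def\<close>)

lemma wnorm_stack_rows:
  assumes "S \<in> carrier_mat m m" "T \<in> carrier_mat m m" "dim_vec c = m"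
  shows "wnorm (stack_fun m a b) (stack_rows m S T *\<^sub>v c) = wnorm a (S *\<^sub>v c) + wnorm b (T *\<^sub>v c)"
proof -
  have 1: "(stack_rows m S T *\<^sub>v c) $ i = (S *\<^sub>v c) $ i"
    and 2: "(stack_rows m S T *\<^sub>v c) $ (m + i) = (T *\<^sub>v c) $ i" if "i < m" for i
    using that assms by (auto simp: stack_rows_def mat_mult_vec_index simp del: index_mult_mat_vec(1))
  have d: "dim_vec (stack_rows m S T *\<^sub>v c) = m + m" "dim_vec (S *\<^sub>v c) = m" "dim_vec (T *\<^sub>v c) = m"
    using assms by (auto simp: stack_rows_def)
  show ?thesis unfolding wnorm_def d sum_lessThan_add
    by (auto simp: stack_fun_def 1 2 simp del: index_mult_mat_vec(1))
qed

text \<open>With \<open>L = V a V\<^sup>*\<close>, \<open>R = V b V\<^sup>*\<close> and likewise \<open>L\<^sub>i\<close>, \<open>R\<^sub>i\<close>, the column of the operators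
  \<open>(s\<^sub>i R\<^sub>i)\<^sup>1\<^sup>/\<^sup>2 R\<^sup>-\<^sup>1\<^sup>/\<^sup>2\<close>, written in the eigenbases, is an isometry that
  compresses \<open>\<Oplus>\<^sub>i L\<^sub>i R\<^sub>i\<^sup>-\<^sup>1\<close> to \<open>L R\<^sup>-\<^sup>1\<close>.\<close>

theorem perspective_concave:
  assumes f: "standard_op_monotone f"
    and V: "unitary_mat m V" "unitary_mat m V1" "unitary_mat m V2"
    and a1: "\<And>i. i < m \<Longrightarrow> 0 < a1 i" and b1: "\<And>i. i < m \<Longrightarrow> 0 < b1 i"
    and a2: "\<And>i. i < m \<Longrightarrow> 0 < a2 i" and b2: "\<And>i. i < m \<Longrightarrow> 0 < b2 i"
    and b: "\<And>i. i < m \<Longrightarrow> 0 < b i" and st: "0 \<le> s" "0 \<le> t"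
    and eqa: "V * mat_diag m (\<lambda>i. complex_of_real (a i)) * cmat_adj V =
      V1 * mat_diag m (\<lambda>i. complex_of_real (s * a1 i)) * cmat_adj V1 +
      V2 * mat_diag m (\<lambda>i. complex_of_real (t * a2 i)) * cmat_adj V2"
    and eqb: "V * mat_diag m (\<lambda>i. complex_of_real (b i)) * cmat_adj V =
      V1 * mat_diag m (\<lambda>i. complex_of_real (s * b1 i)) * cmat_adj V1 +
      V2 * mat_diag m (\<lambda>i. complex_of_real (t * b2 i)) * cmat_adj V2"
    and x: "dim_vec x = m"
  shows "s * wnorm (\<lambda>i. f (a1 i / b1 i) * b1 i) (cmat_adj V1 *\<^sub>v x) +
         t * wnorm (\<lambda>i. f (a2 i / b2 i) * b2 i) (cmat_adj V2 *\<^sub>v x)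
       \<le> wnorm (\<lambda>i. f (a i / b i) * b i) (cmat_adj V *\<^sub>v x)"
proof -
  note Vc = unitary_cancel[OF V(1)] and V1c = unitary_cancel[OF V(2)] and V2c = unitary_cancel[OF V(3)]
  \<comment> \<open>R^(-1/2) in the eigenbasis \<open>V\<close>.\<close>
  define C where "C = mat_diag m (\<lambda>i. complex_of_real (1 / sqrt (b i)))"
  have Cd: "dim_row C = m" "dim_col C = m" "cmat_adj C = C" by (simp_all only: C_def mat_diag_dims cmat_adj_diag)
  define T where "T r b' V' = mat_diag m (\<lambda>i. complex_of_real (sqrt (r * b' i))) * (cmat_adj V' * (V * C))"
    for r b' V'
  have Tc: "T r b' V' \<in> carrier_mat m m" if "unitary_mat m V'" for r b' V'
    unfolding T_def using Vc Cd unitary_cancel[OF that] by (intro carrier_matI) auto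
  \<comment> \<open>All factors between \<open>V'\<close> and its adjoint are diagonal, so the two
    square roots merge with \<open>g\<close>; this is where the commutation of L_i with R_i enters.
    Taking g = 1 will return r R_i, and taking for g the quotient of the eigenvalues will return r
    L_i.\<close>
  have TT: "cmat_adj (T r b' V') * mat_diag m (\<lambda>i. complex_of_real (g i)) * T r b' V'
      = C * (cmat_adj V * (V' * mat_diag m (\<lambda>i. complex_of_real (r * (b' i * g i))) * cmat_adj V') * V) * C"
    if V': "unitary_mat m V'" and r: "0 \<le> r" and b': "\<And>i. i < m \<Longrightarrow> 0 < b' i" for r b' V' g
  proof -
    note c = unitary_cancel[OF V']
    let ?S = "mat_diag m (\<lambda>i. complex_of_real (sqrt (r * b' i)))"
    let ?G = "mat_diag m (\<lambda>i. complex_of_real (g i))"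
    have S: "?S * ?G * ?S = mat_diag m (\<lambda>i. complex_of_real (r * (b' i * g i)))"
    proof -
      have "sqrt (r * b' i) * g i * sqrt (r * b' i) = r * (b' i * g i)" if "i < m" for i
      proof -
        have "sqrt (r * b' i) * sqrt (r * b' i) = r * b' i" using r b'[OF that] by simp
        then show ?thesis by (metis mult.assoc mult.commute)
      qed
      then show ?thesis
        unfolding mat_diag_diag of_real_mult[symmetric]
        by (rule mat_diag_real_cong)
    qed
    have "cmat_adj (T r b' V') * ?G * T r b' V' = C * (cmat_adj V * (V' * (?S * ?G * ?S) * cmat_adj V') * V) * C"
      unfolding T_def using c Vc Cd by (simp add: cmat_adj_mult mat_assoc del: mat_diag_diag)
    then show ?thesis unfolding S .
  qed
  have sum: "C * (cmat_adj V * X * V) * C + C * (cmat_adj V * Y * V) * C = C * (cmat_adj V * (X + Y) * V) * C"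
    if "X \<in> carrier_mat m m" "Y \<in> carrier_mat m m" for X Y
    using that Vc Cd by (simp add: mat_add_mult mat_mult_add)
  have CVC: "C * (cmat_adj V * (V * mat_diag m (\<lambda>i. complex_of_real (g i)) * cmat_adj V) * V) * C
      = mat_diag m (\<lambda>i. complex_of_real (g i / b i))" for g
  proof -
    have "C * (cmat_adj V * (V * mat_diag m (\<lambda>i. complex_of_real (g i)) * cmat_adj V) * V) * C
      = C * mat_diag m (\<lambda>i. complex_of_real (g i)) * C"
      using Vc Cd by (simp add: mat_assoc)
    also have "\<dots> = mat_diag m (\<lambda>i. complex_of_real (1 / sqrt (b i) * g i * (1 / sqrt (b i))))"
      unfolding C_def mat_diag_diag of_real_mult[symmetric] ..
    also have "\<dots> = mat_diag m (\<lambda>i. complex_of_real (g i / b i))"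
    proof -
      have "1 / sqrt (b i) * g i * (1 / sqrt (b i)) = g i / b i" if "i < m" for i
        using b[OF that] by (simp add: field_simps)
      then show ?thesis by (rule mat_diag_real_cong)
    qed
    finally show ?thesis .
  qed
  define W where "W = stack_rows m (T s b1 V1) (T t b2 V2)"
  have congr: "cmat_adj W * mat_diag (m + m) (\<lambda>i. complex_of_real (stack_fun m g1 g2 i)) * W
      = C * (cmat_adj V * (V1 * mat_diag m (\<lambda>i. complex_of_real (s * (b1 i * g1 i))) * cmat_adj V1 +
          V2 * mat_diag m (\<lambda>i. complex_of_real (t * (b2 i * g2 i))) * cmat_adj V2) * V) * C" for g1 g2
    unfolding W_def stack_rows_congruence[OF Tc[OF V(2)] Tc[OF V(3)]]
    using V(2,3) st b1 b2 V1c V2c by (simp only: TT) (rule sum, auto)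
  have W1: "cmat_adj W * W = 1\<^sub>m m"
  proof -
    have "stack_fun m (\<lambda>_. 1) (\<lambda>_. 1) = (\<lambda>_. 1 :: real)" by (auto simp: stack_fun_def)
    hence "cmat_adj W * W = cmat_adj W * mat_diag (m + m) (\<lambda>i. complex_of_real (stack_fun m (\<lambda>_. 1) (\<lambda>_. 1) i)) * W"
      by (simp add: W_def stack_rows_def)
    also have "\<dots> = mat_diag m (\<lambda>i. complex_of_real (b i / b i))"
      unfolding congr CVC[symmetric] eqb by simp
    also have "\<dots> = 1\<^sub>m m" using b by (intro eq_matI) (auto simp: mat_diag_def less_imp_neq[symmetric])
    finally show ?thesis .
  qed
  have W2: "cmat_adj W * mat_diag (m + m) (\<lambda>i. complex_of_real (stack_fun m (\<lambda>i. a1 i / b1 i) (\<lambda>i. a2 i / b2 i) i)) * W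
      = mat_diag m (\<lambda>i. complex_of_real (a i / b i))"
  proof -
    have "mat_diag m (\<lambda>i. complex_of_real (s * (b1 i * (a1 i / b1 i)))) = mat_diag m (\<lambda>i. complex_of_real (s * a1 i))"
      "mat_diag m (\<lambda>i. complex_of_real (t * (b2 i * (a2 i / b2 i)))) = mat_diag m (\<lambda>i. complex_of_real (t * a2 i))"
      by (rule mat_diag_real_cong; use b1 b2 in \<open>simp add: less_imp_neq[symmetric]\<close>)+
    then show ?thesis unfolding congr CVC[symmetric] eqa by simp
  qed
  \<comment> \<open>R^(1/2) x in the coordinates of \<open>V\<close>. It cancels the factor
    \<open>C\<close> in \<open>T\<close>, so each block of \<open>W\<close> applied to
    \<open>c\<close> depends on \<open>x\<close> and its own eigenbasis only.\<close>
  define c where "c = mat_diag m (\<lambda>i. complex_of_real (sqrt (b i))) *\<^sub>v (cmat_adj V *\<^sub>v x)"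
  have dc: "dim_vec c = m" by (simp add: c_def)
  have Cc: "C *\<^sub>v c = cmat_adj V *\<^sub>v x"
  proof (rule eq_vecI)
    fix i assume "i < dim_vec (cmat_adj V *\<^sub>v x)"
    hence i: "i < m" using Vc by simp
    have "(C *\<^sub>v c) $ i = complex_of_real (1 / sqrt (b i)) * (complex_of_real (sqrt (b i)) * (cmat_adj V *\<^sub>v x) $ i)"
      unfolding C_def c_def using i Vc by (simp del: index_mult_mat_vec(1))
    then show "(C *\<^sub>v c) $ i = (cmat_adj V *\<^sub>v x) $ i" using b[OF i] by (simp del: index_mult_mat_vec(1))
  qed (use Vc Cd in simp)
  have Tcv: "T r b' V' *\<^sub>v c = mat_diag m (\<lambda>i. complex_of_real (sqrt (r * b' i))) *\<^sub>v (cmat_adj V' *\<^sub>v x)"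
    if "unitary_mat m V'" for r b' V'
    unfolding T_def using Vc Cd dc unitary_cancel[OF that] x by (simp add: mat_vec_assoc Cc)
  have "wnorm (\<lambda>i. f (stack_fun m (\<lambda>i. a1 i / b1 i) (\<lambda>i. a2 i / b2 i) i)) (W *\<^sub>v c)
      \<le> wnorm (\<lambda>i. f (a i / b i)) c"
    by (rule compression_inequality[OF f _ _ W1 W2 dc])
      (use a1 b1 a2 b2 in \<open>auto simp: W_def stack_fun_def\<close>)
  also have "(\<lambda>i. f (stack_fun m (\<lambda>i. a1 i / b1 i) (\<lambda>i. a2 i / b2 i) i))
      = stack_fun m (\<lambda>i. f (a1 i / b1 i)) (\<lambda>i. f (a2 i / b2 i))"
    by (auto simp: stack_fun_def)
  also have "wnorm \<dots> (W *\<^sub>v c) = wnorm (\<lambda>i. f (a1 i / b1 i)) (T s b1 V1 *\<^sub>v c) + wnorm (\<lambda>i. f (a2 i / b2 i)) (T t b2 V2 *\<^sub>v c)"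
    unfolding W_def by (rule wnorm_stack_rows[OF Tc[OF V(2)] Tc[OF V(3)] dc])
  also have "wnorm (\<lambda>i. f (a1 i / b1 i)) (T s b1 V1 *\<^sub>v c) = s * wnorm (\<lambda>i. f (a1 i / b1 i) * b1 i) (cmat_adj V1 *\<^sub>v x)"
    unfolding Tcv[OF V(2)] using V1c st b1
    by (subst wnorm_diag_scale) (auto simp: less_imp_le mult.left_commute simp flip: wnorm_scale)
  also have "wnorm (\<lambda>i. f (a2 i / b2 i)) (T t b2 V2 *\<^sub>v c) = t * wnorm (\<lambda>i. f (a2 i / b2 i) * b2 i) (cmat_adj V2 *\<^sub>v x)"
    unfolding Tcv[OF V(3)] using V2c st b2
    by (subst wnorm_diag_scale) (auto simp: less_imp_le mult.left_commute simp flip: wnorm_scale)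
  also have "wnorm (\<lambda>i. f (a i / b i)) c = wnorm (\<lambda>i. f (a i / b i) * b i) (cmat_adj V *\<^sub>v x)"
    unfolding c_def using Vc b by (intro wnorm_diag_scale) (auto simp: less_imp_le)
  finally show ?thesis .
qed

section \<open>Superoperators as Kronecker products\<close>

lemma div_mod_less: "(p :: nat) < n * n \<Longrightarrow> p div n < n" "(p :: nat) < n * n \<Longrightarrow> p mod n < n"
  by (simp_all add: less_mult_imp_div_less) (metis mod_less_divisor mult_is_0 neq0_conv not_less_zero)

lemma sum_div_mod: "(\<Sum>r<n * n. g (r div n) (r mod n)) = (\<Sum>a<n. \<Sum>b<n. g a b)"
  for g :: "nat \<Rightarrow> nat \<Rightarrow> 'a :: comm_monoid_add"
proof -
  have "(\<Sum>r<n * n. g (r div n) (r mod n)) = (\<Sum>m<n. \<Sum>r\<in>{m * n..<m * n + n}. g (r div n) (r mod n))"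
    by (rule sum.nat_group[symmetric])
  also have "\<dots> = (\<Sum>a<n. \<Sum>b<n. g a b)"
  proof (rule sum.cong[OF refl])
    fix m
    have "(\<Sum>r\<in>{m * n..<m * n + n}. g (r div n) (r mod n)) = (\<Sum>b\<in>{0..<n}. g ((b + m * n) div n) ((b + m * n) mod n))"
      using sum.shift_bounds_nat_ivl[of "\<lambda>r. g (r div n) (r mod n)" 0 "m * n" n] by (simp only: add_0 add.commute)
    also have "\<dots> = (\<Sum>b\<in>{0..<n}. g m b)"
      by (intro sum.cong) auto
    finally show "(\<Sum>r\<in>{m * n..<m * n + n}. g (r div n) (r mod n)) = (\<Sum>b<n. g m b)"
      by (simp only: atLeast0LessThan)
  qed
  finally show ?thesis .
qed

text \<open>The index splits as in \<open>vec_of_mat\<close>, by rows, so that X \<mapsto> A X B has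
  the matrix \<open>kron n A (transpose_mat B)\<close>.\<close>

definition kron :: "nat \<Rightarrow> complex mat \<Rightarrow> complex mat \<Rightarrow> complex mat" where
  "kron n A B = mat (n * n) (n * n) (\<lambda>(p, q). A $$ (p div n, q div n) * B $$ (p mod n, q mod n))"

lemma kron_dim [simp]: "dim_row (kron n A B) = n * n" "dim_col (kron n A B) = n * n"
  by (simp_all add: kron_def)

lemma kron_index: "p < n * n \<Longrightarrow> q < n * n \<Longrightarrow>
    kron n A B $$ (p, q) = A $$ (p div n, q div n) * B $$ (p mod n, q mod n)"
  by (simp add: kron_def)

lemma kron_mult:
  assumes "A \<in> carrier_mat n n" "B \<in> carrier_mat n n" "C \<in> carrier_mat n n" "D \<in> carrier_mat n n"
  shows "kron n A B * kron n C D = kron n (A * C) (B * D)"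
proof (rule eq_matI)
  fix p q assume "p < dim_row (kron n (A * C) (B * D))" "q < dim_col (kron n (A * C) (B * D))"
  hence pq: "p < n * n" "q < n * n" by auto
  have "(kron n A B * kron n C D) $$ (p, q) = (\<Sum>r<n * n. kron n A B $$ (p, r) * kron n C D $$ (r, q))"
    using pq by (subst mat_mult_index) auto
  also have "\<dots> = (\<Sum>r<n * n. A $$ (p div n, r div n) * B $$ (p mod n, r mod n)
      * (C $$ (r div n, q div n) * D $$ (r mod n, q mod n)))"
    using pq by (intro sum.cong) (auto simp: kron_index)
  also have "\<dots> = (\<Sum>a<n. \<Sum>b<n. A $$ (p div n, a) * B $$ (p mod n, b) * (C $$ (a, q div n) * D $$ (b, q mod n)))"
    by (rule sum_div_mod)
  also have "\<dots> = (\<Sum>a<n. A $$ (p div n, a) * C $$ (a, q div n)) * (\<Sum>b<n. B $$ (p mod n, b) * D $$ (b, q mod n))"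
    by (simp add: sum_product mult_ac)
  also have "\<dots> = (A * C) $$ (p div n, q div n) * (B * D) $$ (p mod n, q mod n)"
    using assms pq div_mod_less[OF pq(1)] div_mod_less[OF pq(2)]
    by (simp add: mat_mult_index del: index_mult_mat(1))
  also have "\<dots> = kron n (A * C) (B * D) $$ (p, q)" using pq by (simp add: kron_index)
  finally show "(kron n A B * kron n C D) $$ (p, q) = kron n (A * C) (B * D) $$ (p, q)" .
qed auto

lemma cmat_adj_kron:
  assumes "A \<in> carrier_mat n n" "B \<in> carrier_mat n n"
  shows "cmat_adj (kron n A B) = kron n (cmat_adj A) (cmat_adj B)"
  using assms by (intro eq_matI) (auto simp: kron_index div_mod_less)

lemma div_mod_eq_iff: "(p :: nat) div n = q div n \<and> p mod n = q mod n \<longleftrightarrow> p = q"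
  by (metis div_mult_mod_eq)

lemma kron_diag:
  "kron n (mat_diag n a) (mat_diag n b) = mat_diag (n * n) (\<lambda>p. a (p div n) * b (p mod n))"
  using div_mod_eq_iff[of _ n]
  by (intro eq_matI) (auto simp: kron_index mat_diag_def div_mod_less)

lemma kron_one: "kron n (1\<^sub>m n) (1\<^sub>m n) = 1\<^sub>m (n * n)"
  using kron_diag[of n "\<lambda>_. 1" "\<lambda>_. 1"] by simp

lemma unitary_kron:
  assumes "unitary_mat n U" "unitary_mat n V"
  shows "unitary_mat (n * n) (kron n U V)"
proof -
  have "U \<in> carrier_mat n n" "V \<in> carrier_mat n n" using assms by (auto simp: unitary_mat_def)
  then show ?thesis
    using unitary_cancel(3,4)[OF assms(1)] unitary_cancel(3,4)[OF assms(2)]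
    by (auto simp: unitary_mat_def cmat_adj_kron kron_mult kron_one intro: carrier_matI)
qed

lemma kron_spectral:
  assumes "U \<in> carrier_mat n n" "V \<in> carrier_mat n n"
  shows "kron n (U * mat_diag n a * cmat_adj U) (V * mat_diag n b * cmat_adj V)
    = kron n U V * mat_diag (n * n) (\<lambda>p. a (p div n) * b (p mod n)) * cmat_adj (kron n U V)"
proof -
  have c: "cmat_adj U \<in> carrier_mat n n" "cmat_adj V \<in> carrier_mat n n"
    "U * mat_diag n a \<in> carrier_mat n n" "V * mat_diag n b \<in> carrier_mat n n"
    using assms by auto
  show ?thesis
    unfolding kron_diag[symmetric] cmat_adj_kron[OF assms]
      kron_mult[OF assms mat_diag_dim mat_diag_dim] kron_mult[OF c(3,4) c(1,2)] ..
qed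

lemma kron_linear_left:
  assumes "X \<in> carrier_mat n n" "Y \<in> carrier_mat n n"
  shows "kron n (s \<cdot>\<^sub>m X + t \<cdot>\<^sub>m Y) B = s \<cdot>\<^sub>m kron n X B + t \<cdot>\<^sub>m kron n Y B"
  using assms by (intro eq_matI) (auto simp: kron_index div_mod_less algebra_simps)

lemma kron_linear_right:
  assumes "X \<in> carrier_mat n n" "Y \<in> carrier_mat n n"
  shows "kron n B (s \<cdot>\<^sub>m X + t \<cdot>\<^sub>m Y) = s \<cdot>\<^sub>m kron n B X + t \<cdot>\<^sub>m kron n B Y"
  using assms by (intro eq_matI) (auto simp: kron_index div_mod_less algebra_simps)

section \<open>Matrices of left and right multiplication\<close>

lemma sop_mat_left:
  assumes "\<rho> \<in> carrier_mat n n"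
  shows "sop_mat n (\<lambda>Y. \<rho> * Y) = kron n \<rho> (1\<^sub>m n)"
proof -
  have "(\<rho> * matunit n k l) $$ (i, j) = \<rho> $$ (i, k) * 1\<^sub>m n $$ (j, l)"
    if "i < n" "j < n" "k < n" "l < n" for i j k l
  proof -
    have "(\<rho> * matunit n k l) $$ (i, j) = (\<Sum>m<n. \<rho> $$ (i, m) * matunit n k l $$ (m, j))"
      using that assms by (subst mat_mult_index) (auto simp: matunit_def)
    also have "\<dots> = (\<Sum>m<n. if m = k then \<rho> $$ (i, k) * 1\<^sub>m n $$ (j, l) else 0)"
      using that by (intro sum.cong) (auto simp: matunit_def)
    finally show ?thesis using that by simp
  qed
  then show ?thesis
    by (intro eq_matI) (auto simp: sop_mat_def kron_index div_mod_less)
qed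

lemma sop_mat_right:
  assumes "\<rho> \<in> carrier_mat n n"
  shows "sop_mat n (\<lambda>Y. Y * \<rho>) = kron n (1\<^sub>m n) (transpose_mat \<rho>)"
proof -
  have "(matunit n k l * \<rho>) $$ (i, j) = 1\<^sub>m n $$ (i, k) * transpose_mat \<rho> $$ (j, l)"
    if "i < n" "j < n" "k < n" "l < n" for i j k l
  proof -
    have "(matunit n k l * \<rho>) $$ (i, j) = (\<Sum>m<n. matunit n k l $$ (i, m) * \<rho> $$ (m, j))"
      using that assms by (subst mat_mult_index) (auto simp: matunit_def)
    also have "\<dots> = (\<Sum>m<n. if m = l then 1\<^sub>m n $$ (i, k) * transpose_mat \<rho> $$ (j, l) else 0)"
      using that assms by (intro sum.cong) (auto simp: matunit_def)
    finally show ?thesis using that by simp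
  qed
  then show ?thesis
    by (intro eq_matI) (auto simp: sop_mat_def kron_index div_mod_less)
qed

section \<open>The operator \<open>J\<close> in an eigenbasis\<close>

text \<open>The form of \<open>\<rho>\<close> at the j-th column of \<open>U\<close> is the j-th
  eigenvalue.\<close>

lemma posdef_spectral:
  assumes "posdef_mat n \<rho>"
  obtains U lam where "unitary_mat n U" "\<forall>i<n. 0 < lam i"
    "\<rho> = U * mat_diag n (\<lambda>i. complex_of_real (lam i)) * cmat_adj U"
proof -
  obtain U lam where U: "unitary_mat n U"
    and \<rho>: "\<rho> = U * mat_diag n (\<lambda>i. complex_of_real (lam i)) * cmat_adj U"
    using spectral_theorem[of n \<rho>] assms unfolding posdef_mat_def by blast
  note Uc = unitary_cancel[OF U]
  have "0 < lam j" if j: "j < n" for j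
  proof -
    let ?v = "U *\<^sub>v unit_vec n j"
    have v: "cmat_adj U *\<^sub>v ?v = unit_vec n j" using Uc by simp
    have "?v \<noteq> 0\<^sub>v n"
      using isometry_unit_vec_nonzero[OF Uc(2,4) j] Uc by simp
    moreover have "?v \<in> carrier_vec n" by (rule carrier_vecI) (use Uc in simp)
    ultimately have "0 < Re (qform \<rho> ?v)" using assms by (simp add: posdef_mat_def)
    also have "qform \<rho> ?v = of_real (wnorm lam (unit_vec n j))"
      unfolding \<rho> using qform_spectral[of U n n ?v lam] Uc v by simp
    finally show ?thesis using wnorm_unit_vec[OF j] by simp
  qed
  then show ?thesis using that U \<rho> by blast
qed

text \<open>Two-sided inverses are unique, which determines the value of the choice in
  \<open>minv\<close>.\<close>

lemma minv_eq:
  assumes "B \<in> carrier_mat n n" "\<rho> * B = 1\<^sub>m n" "B * \<rho> = 1\<^sub>m n" "\<rho> \<in> carrier_mat n n"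
  shows "minv n \<rho> = B"
proof -
  let ?P = "\<lambda>B. B \<in> carrier_mat n n \<and> \<rho> * B = 1\<^sub>m n \<and> B * \<rho> = 1\<^sub>m n"
  have "?P (minv n \<rho>)" unfolding minv_def by (rule someI[of ?P B]) (use assms in auto)
  then have "minv n \<rho> = minv n \<rho> * (\<rho> * B)" "minv n \<rho> * \<rho> * B = B" "minv n \<rho> \<in> carrier_mat n n"
    using assms by auto
  then show ?thesis using assms by (simp add: mat_assoc)
qed

lemma minv_spectral:
  assumes U: "unitary_mat n U" and lam: "\<forall>i<n. 0 < lam i"
  shows "minv n (U * mat_diag n (\<lambda>i. complex_of_real (lam i)) * cmat_adj U)
    = U * mat_diag n (\<lambda>i. complex_of_real (1 / lam i)) * cmat_adj U"
proof -
  note Uc = unitary_cancel[OF U]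
  let ?D = "mat_diag n (\<lambda>i. complex_of_real (lam i))"
  let ?E = "mat_diag n (\<lambda>i. complex_of_real (1 / lam i))"
  have e: "?D * ?E = 1\<^sub>m n" "?E * ?D = 1\<^sub>m n"
    using lam by (auto simp: mat_diag_def less_imp_neq[symmetric] intro!: eq_matI simp flip: mat_diag_one
        simp: mat_diag_diag[unfolded mat_diag_def])
  have "U * ?D * cmat_adj U * (U * ?E * cmat_adj U) = U * (?D * ?E) * cmat_adj U"
    "U * ?E * cmat_adj U * (U * ?D * cmat_adj U) = U * (?E * ?D) * cmat_adj U"
    using Uc by (simp_all add: mat_assoc del: mat_diag_diag)
  then show ?thesis
    unfolding e using Uc by (intro minv_eq carrier_matI) auto
qed

text \<open>The columns of this matrix are the vectorised matrices \<open>U E\<^sub>a\<^sub>b U\<^sup>*\<close>, the common eigenvectors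
  of left and right multiplication by any \<open>\<rho>\<close> that \<open>U\<close> diagonalises.\<close>

definition eigenbasis :: "nat \<Rightarrow> complex mat \<Rightarrow> complex mat" where
  "eigenbasis n U = kron n U (transpose_mat (cmat_adj U))"

text \<open>The transposed adjoint is the entrywise conjugate of \<open>U\<close>. It appears
  because right multiplication acts through the transpose of \<open>\<rho>\<close>, whose
  eigenvectors are the conjugates of those of \<open>\<rho>\<close>.\<close>

lemma unitary_transpose_adj:
  assumes "unitary_mat n U"
  shows "unitary_mat n (transpose_mat (cmat_adj U))"
proof -
  have U: "U \<in> carrier_mat n n" using assms by (simp add: unitary_mat_def)
  have "cmat_adj (transpose_mat (cmat_adj U)) = transpose_mat U"
    using U by (intro eq_matI) auto
  moreover have "transpose_mat (cmat_adj U) * transpose_mat U = 1\<^sub>m n"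
    "transpose_mat U * transpose_mat (cmat_adj U) = 1\<^sub>m n"
    unfolding transpose_mult[OF U cmat_adj_carrier[OF U], symmetric]
      transpose_mult[OF cmat_adj_carrier[OF U] U, symmetric] unitary_cancel(3,4)[OF assms] by simp_all
  ultimately show ?thesis using U by (simp add: unitary_mat_def)
qed

lemma unitary_eigenbasis: "unitary_mat n U \<Longrightarrow> unitary_mat (n * n) (eigenbasis n U)"
  unfolding eigenbasis_def by (intro unitary_kron unitary_transpose_adj)

text \<open>The identity in the second factor is diagonal in any orthonormal basis; choosing the
  conjugate of \<open>U\<close> there gives L the same eigenvectors as R.\<close>

lemma eigenbasis_left:
  assumes U: "unitary_mat n U"
  shows "kron n (U * mat_diag n (\<lambda>i. complex_of_real (a i)) * cmat_adj U) (1\<^sub>m n)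
    = eigenbasis n U * mat_diag (n * n) (\<lambda>p. complex_of_real (a (p div n))) * cmat_adj (eigenbasis n U)"
proof -
  let ?V = "transpose_mat (cmat_adj U)"
  have V: "unitary_mat n ?V" by (rule unitary_transpose_adj[OF U])
  have "1\<^sub>m n = ?V * mat_diag n (\<lambda>i. 1) * cmat_adj ?V"
    using unitary_cancel[OF V] by simp
  then show ?thesis
    using kron_spectral[of U n ?V "\<lambda>i. complex_of_real (a i)" "\<lambda>i. 1"] U V
    by (simp add: unitary_mat_def eigenbasis_def)
qed

text \<open>Transposing U D U^* gives conj(U) D conj(U)^*, and the identity in the first factor is
  now expanded in the basis \<open>U\<close>.\<close>

lemma eigenbasis_right:
  assumes U: "unitary_mat n U"
  shows "kron n (1\<^sub>m n) (transpose_mat (U * mat_diag n (\<lambda>i. complex_of_real (a i)) * cmat_adj U))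
    = eigenbasis n U * mat_diag (n * n) (\<lambda>p. complex_of_real (a (p mod n))) * cmat_adj (eigenbasis n U)"
proof -
  let ?V = "transpose_mat (cmat_adj U)"
  let ?D = "mat_diag n (\<lambda>i. complex_of_real (a i))"
  have Uc: "U \<in> carrier_mat n n" using U by (simp add: unitary_mat_def)
  have V: "unitary_mat n ?V" by (rule unitary_transpose_adj[OF U])
  have aV: "cmat_adj ?V = transpose_mat U"
    using Uc by (intro eq_matI) auto
  have D: "transpose_mat ?D = ?D" by (rule eq_matI) (auto simp: mat_diag_def)
  have "transpose_mat (U * ?D * cmat_adj U) = ?V * (transpose_mat ?D * transpose_mat U)"
    using transpose_mult[of "U * ?D" n n "cmat_adj U" n] transpose_mult[of U n n ?D n] Uc by simp
  also have "\<dots> = ?V * ?D * cmat_adj ?V"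
    unfolding D aV using Uc by (simp add: mat_assoc)
  finally have t: "transpose_mat (U * ?D * cmat_adj U) = ?V * ?D * cmat_adj ?V" .
  have "1\<^sub>m n = U * mat_diag n (\<lambda>i. 1) * cmat_adj U"
    using unitary_cancel[OF U] by simp
  then show ?thesis unfolding t
    using kron_spectral[of U n ?V "\<lambda>i. 1" "\<lambda>i. complex_of_real (a i)"] U V
    by (simp add: unitary_mat_def eigenbasis_def)
qed

lemma vec_of_mat_dim [simp]: "dim_vec (vec_of_mat n X) = n * n"
  by (simp add: vec_of_mat_def)

lemma hs_inner_mat_of_vec:
  assumes A: "A \<in> carrier_mat n n" and w: "dim_vec w = n * n"
  shows "hs_inner A (mat_of_vec n w) = cinner (vec_of_mat n A) w"
proof -
  have "hs_inner A (mat_of_vec n w) = (\<Sum>i<n. \<Sum>k<n. cnj (A $$ (k, i)) * w $ (k * n + i))"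
    unfolding hs_inner_def mtrace_def using A
    by (auto simp: mat_mult_index mat_of_vec_def simp del: index_mult_mat(1) intro!: sum.cong)
  also have "\<dots> = (\<Sum>k<n. \<Sum>i<n. cnj (A $$ (k, i)) * w $ (k * n + i))" by (rule sum.swap)
  also have "\<dots> = (\<Sum>p<n * n. cnj (A $$ (p div n, p mod n)) * w $ (p div n * n + p mod n))"
    by (rule sum_div_mod[symmetric])
  also have "\<dots> = cinner (vec_of_mat n A) w"
    unfolding cinner_def w by (intro sum.cong) (auto simp: vec_of_mat_def)
  finally show ?thesis .
qed

text \<open>L, R and R^-1 are diagonal in the same basis, so f(L R^-1) R is too. The resulting
  number is the sum of f(lam_i / lam_j) lam_j |(U^* A U)_ij|^2; being real, it loses nothing when
  real parts are taken later.\<close>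

lemma hs_inner_Jf:
  assumes U: "unitary_mat n U" and lam: "\<forall>i<n. 0 < lam i"
    and \<rho>: "\<rho> = U * mat_diag n (\<lambda>i. complex_of_real (lam i)) * cmat_adj U" and A: "A \<in> carrier_mat n n"
  shows "hs_inner A (Jf f \<rho> A) = complex_of_real
    (wnorm (\<lambda>p. f (lam (p div n) / lam (p mod n)) * lam (p mod n)) (cmat_adj (eigenbasis n U) *\<^sub>v vec_of_mat n A))"
proof -
  note Uc = unitary_cancel[OF U]
  let ?K = "eigenbasis n U"
  note K = unitary_eigenbasis[OF U]
  note Kc = unitary_cancel[OF K]
  let ?S = "\<lambda>g. ?K * mat_diag (n * n) (\<lambda>p. complex_of_real (g p)) * cmat_adj ?K"
  have S: "?S g * ?S h = ?S (\<lambda>p. g p * h p)" for g h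
    using Kc by (simp add: mat_assoc del: mat_diag_diag) (simp flip: mat_assoc)
  have dr: "dim_row \<rho> = n" using \<rho> Uc by simp
  have \<rho>c: "\<rho> \<in> carrier_mat n n" unfolding \<rho> using Uc by (intro carrier_matI) auto
  have L: "sop_mat n (\<lambda>Y. \<rho> * Y) = ?S (\<lambda>p. lam (p div n))"
    unfolding sop_mat_left[OF \<rho>c] unfolding \<rho> by (rule eigenbasis_left[OF U])
  have R: "sop_mat n (\<lambda>Y. Y * \<rho>) = ?S (\<lambda>p. lam (p mod n))"
    unfolding sop_mat_right[OF \<rho>c] unfolding \<rho> by (rule eigenbasis_right[OF U])
  have m: "minv n \<rho> = U * mat_diag n (\<lambda>i. complex_of_real (1 / lam i)) * cmat_adj U"
    unfolding \<rho> by (rule minv_spectral[OF U lam])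
  have mc: "minv n \<rho> \<in> carrier_mat n n" unfolding m using Uc by (intro carrier_matI) auto
  have Ri: "sop_mat n (\<lambda>Y. Y * minv n \<rho>) = ?S (\<lambda>p. 1 / lam (p mod n))"
    unfolding sop_mat_right[OF mc] unfolding m by (rule eigenbasis_right[OF U])
  have LR: "sop_mat n (\<lambda>Y. \<rho> * Y) * sop_mat n (\<lambda>Y. Y * minv n \<rho>) = ?S (\<lambda>p. lam (p div n) / lam (p mod n))"
    unfolding L Ri S by simp
  let ?g = "\<lambda>p. f (lam (p div n) / lam (p mod n)) * lam (p mod n)"
  have J: "Jf f \<rho> A = mat_of_vec n (?S ?g *\<^sub>v vec_of_mat n A)"
    unfolding Jf_def Let_def dr LR mat_fun_spectral[OF K refl] R S ..
  have "hs_inner A (Jf f \<rho> A) = cinner (vec_of_mat n A) (?S ?g *\<^sub>v vec_of_mat n A)"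
    unfolding J by (rule hs_inner_mat_of_vec[OF A]) (use Kc in simp)
  also have "\<dots> = qform (?S ?g) (vec_of_mat n A)"
    by (rule qform_cinner[symmetric]) (use Kc in \<open>auto intro!: carrier_matI\<close>)
  also have "\<dots> = of_real (wnorm ?g (cmat_adj ?K *\<^sub>v vec_of_mat n A))"
    by (rule qform_spectral) (use Kc in auto)
  finally show ?thesis .
qed

section \<open>Concavity of the uncentred form\<close>

lemma posdef_convex:
  assumes p: "posdef_mat n \<rho>1" "posdef_mat n \<rho>2" and st: "0 \<le> s" "0 \<le> t" "s + t = 1"
  shows "posdef_mat n (complex_of_real s \<cdot>\<^sub>m \<rho>1 + complex_of_real t \<cdot>\<^sub>m \<rho>2)"
proof -
  have h: "hermitian_mat n \<rho>1" "hermitian_mat n \<rho>2" using p by (auto simp: posdef_mat_def)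
  have c: "\<rho>1 \<in> carrier_mat n n" "\<rho>2 \<in> carrier_mat n n" using h by (auto simp: hermitian_mat_def)
  show ?thesis unfolding posdef_mat_def
  proof (intro conjI ballI impI)
    show "hermitian_mat n (complex_of_real s \<cdot>\<^sub>m \<rho>1 + complex_of_real t \<cdot>\<^sub>m \<rho>2)"
      by (intro hermitian_add hermitian_smult h)
    fix v :: "complex vec" assume v: "v \<in> carrier_vec n" "v \<noteq> 0\<^sub>v n"
    have "0 < Re (qform \<rho>1 v)" "0 < Re (qform \<rho>2 v)" using p v by (auto simp: posdef_mat_def)
    moreover have "s > 0 \<or> t > 0" using st by linarith
    ultimately have "0 < s * Re (qform \<rho>1 v) + t * Re (qform \<rho>2 v)"
      using st by (auto intro: add_pos_nonneg add_nonneg_pos)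
    then show "0 < Re (qform (complex_of_real s \<cdot>\<^sub>m \<rho>1 + complex_of_real t \<cdot>\<^sub>m \<rho>2) v)"
      using c v by (simp add: qform_add qform_smult)
  qed
qed

lemma spectral_smult:
  assumes "dim_col V = m"
  shows "complex_of_real k \<cdot>\<^sub>m (V * mat_diag m (\<lambda>i. complex_of_real (d i)) * cmat_adj V)
    = V * mat_diag m (\<lambda>i. complex_of_real (k * d i)) * cmat_adj V"
proof -
  have V: "V \<in> carrier_mat (dim_row V) m" using assms by auto
  have "V * mat_diag m (\<lambda>i. complex_of_real (k * d i)) = complex_of_real k \<cdot>\<^sub>m (V * mat_diag m (\<lambda>i. complex_of_real (d i)))"
    unfolding mat_diag_mult_right[OF V] by (rule eq_matI) auto
  then show ?thesis
    by (simp only:) (rule mult_smult_assoc_mat[symmetric, of _ "dim_row V" m _ "dim_row V"];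
      use assms in \<open>auto intro!: carrier_matI\<close>)
qed

lemma hs_inner_Jf_concave:
  assumes f: "standard_op_monotone f" and A: "A \<in> carrier_mat n n"
    and p: "posdef_mat n \<rho>1" "posdef_mat n \<rho>2" and st: "0 \<le> s" "0 \<le> t" "s + t = 1"
  shows "s * Re (hs_inner A (Jf f \<rho>1 A)) + t * Re (hs_inner A (Jf f \<rho>2 A))
    \<le> Re (hs_inner A (Jf f (complex_of_real s \<cdot>\<^sub>m \<rho>1 + complex_of_real t \<cdot>\<^sub>m \<rho>2) A))"
proof -
  define \<rho> where "\<rho> = complex_of_real s \<cdot>\<^sub>m \<rho>1 + complex_of_real t \<cdot>\<^sub>m \<rho>2"
  obtain U lam where U: "unitary_mat n U" and lam: "\<forall>i<n. 0 < lam i"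
    and \<rho>: "\<rho> = U * mat_diag n (\<lambda>i. complex_of_real (lam i)) * cmat_adj U"
    using posdef_spectral[OF posdef_convex[OF p st], folded \<rho>_def] by blast
  obtain U1 lam1 where U1: "unitary_mat n U1" and lam1: "\<forall>i<n. 0 < lam1 i"
    and \<rho>1: "\<rho>1 = U1 * mat_diag n (\<lambda>i. complex_of_real (lam1 i)) * cmat_adj U1"
    using posdef_spectral[OF p(1)] by blast
  obtain U2 lam2 where U2: "unitary_mat n U2" and lam2: "\<forall>i<n. 0 < lam2 i"
    and \<rho>2: "\<rho>2 = U2 * mat_diag n (\<lambda>i. complex_of_real (lam2 i)) * cmat_adj U2"
    using posdef_spectral[OF p(2)] by blast
  have c: "\<rho>1 \<in> carrier_mat n n" "\<rho>2 \<in> carrier_mat n n"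
    using p by (auto simp: posdef_mat_def hermitian_mat_def)
  note K1 = unitary_cancel(2)[OF unitary_eigenbasis[OF U1]] and K2 = unitary_cancel(2)[OF unitary_eigenbasis[OF U2]]
  \<comment> \<open>R sees \<open>\<rho>\<close> through its transpose. Transposition is linear and
    involves no conjugation, so the mixture is preserved.\<close>
  have tr: "transpose_mat \<rho> = complex_of_real s \<cdot>\<^sub>m transpose_mat \<rho>1 + complex_of_real t \<cdot>\<^sub>m transpose_mat \<rho>2"
    unfolding \<rho>_def using c by (intro eq_matI) auto
  show ?thesis
    unfolding \<rho>_def[symmetric] hs_inner_Jf[OF U lam \<rho> A] hs_inner_Jf[OF U1 lam1 \<rho>1 A] hs_inner_Jf[OF U2 lam2 \<rho>2 A]
      Re_complex_of_real
  proof (rule perspective_concave[OF f unitary_eigenbasis[OF U] unitary_eigenbasis[OF U1] unitary_eigenbasis[OF U2]])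
    show "eigenbasis n U * mat_diag (n * n) (\<lambda>p. complex_of_real (lam (p div n))) * cmat_adj (eigenbasis n U) =
      eigenbasis n U1 * mat_diag (n * n) (\<lambda>p. complex_of_real (s * lam1 (p div n))) * cmat_adj (eigenbasis n U1) +
      eigenbasis n U2 * mat_diag (n * n) (\<lambda>p. complex_of_real (t * lam2 (p div n))) * cmat_adj (eigenbasis n U2)"
      \<comment> \<open>Folding the spectral forms back leaves an identity between L for the mixture
        and the mixture of the two operators L.\<close>
      unfolding spectral_smult[OF K1, symmetric] spectral_smult[OF K2, symmetric]
        eigenbasis_left[OF U, symmetric] eigenbasis_left[OF U1, symmetric] eigenbasis_left[OF U2, symmetric]
        \<rho>[symmetric] \<rho>1[symmetric] \<rho>2[symmetric]
      unfolding \<rho>_def by (rule kron_linear_left[OF c])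
    show "eigenbasis n U * mat_diag (n * n) (\<lambda>p. complex_of_real (lam (p mod n))) * cmat_adj (eigenbasis n U) =
      eigenbasis n U1 * mat_diag (n * n) (\<lambda>p. complex_of_real (s * lam1 (p mod n))) * cmat_adj (eigenbasis n U1) +
      eigenbasis n U2 * mat_diag (n * n) (\<lambda>p. complex_of_real (t * lam2 (p mod n))) * cmat_adj (eigenbasis n U2)"
      unfolding spectral_smult[OF K1, symmetric] spectral_smult[OF K2, symmetric]
        eigenbasis_right[OF U, symmetric] eigenbasis_right[OF U1, symmetric] eigenbasis_right[OF U2, symmetric]
        \<rho>[symmetric] \<rho>1[symmetric] \<rho>2[symmetric]
      unfolding tr by (rule kron_linear_right) (use c in auto)
  qed (use lam lam1 lam2 st in \<open>auto simp: div_mod_less\<close>)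
qed

section \<open>Concavity of the covariance\<close>

lemma mtrace_mult:
  assumes "A \<in> carrier_mat n n" "B \<in> carrier_mat n n"
  shows "mtrace (A * B) = (\<Sum>i<n. \<Sum>k<n. A $$ (i, k) * B $$ (k, i))"
  using assms by (auto simp: mtrace_def mat_mult_index simp del: index_mult_mat(1))

text \<open>Conjugation transposes both factors entrywise, and exchanging the summation indices
  restores the trace. A real trace is needed so that the real part of its square is the square of
  its real part.\<close>

lemma mtrace_mult_hermitian_real:
  assumes "hermitian_mat n A" "hermitian_mat n B"
  shows "Im (mtrace (A * B)) = 0"
proof -
  have c: "A \<in> carrier_mat n n" "B \<in> carrier_mat n n" using assms by (auto simp: hermitian_mat_def)
  have sym: "cnj (X $$ (i, k)) = X $$ (k, i)" if "hermitian_mat n X" "i < n" "k < n" for X i k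
    using that cmat_adj_index[of k X i] by (auto simp: hermitian_mat_def)
  have "cnj (mtrace (A * B)) = (\<Sum>i<n. \<Sum>k<n. A $$ (k, i) * B $$ (i, k))"
    by (simp add: mtrace_mult[OF c] sym[OF assms(1)] sym[OF assms(2)])
  also have "\<dots> = mtrace (A * B)"
    unfolding mtrace_mult[OF c] by (rule sum.swap)
  finally show ?thesis by (metis Reals_cnj_iff complex_is_Real_iff)
qed

lemma Re_qCov_hermitian:
  assumes "hermitian_mat n A" "hermitian_mat n \<rho>"
  shows "Re (qCov f \<rho> A A) = Re (hs_inner A (Jf f \<rho> A)) - (Re (mtrace (\<rho> * A)))\<^sup>2"
proof -
  have "cmat_adj A = A" using assms by (simp add: hermitian_mat_def)
  then show ?thesis
    using mtrace_mult_hermitian_real[OF assms(2,1)] by (simp add: qCov_def power2_eq_square)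
qed

text \<open>The defect is the variance s t (x - y)^2 of a two-point distribution.\<close>

lemma square_convex:
  fixes x y s t :: real
  assumes "0 \<le> s" "0 \<le> t" "s + t = 1"
  shows "(s * x + t * y)\<^sup>2 \<le> s * x\<^sup>2 + t * y\<^sup>2"
proof -
  have t: "t = 1 - s" using assms by simp
  have "s * x\<^sup>2 + t * y\<^sup>2 - (s * x + t * y)\<^sup>2 = s * t * (x - y)\<^sup>2"
    unfolding t by (simp add: power2_eq_square algebra_simps)
  moreover have "0 \<le> s * t * (x - y)\<^sup>2" using assms by simp
  ultimately show ?thesis by linarith
qed

theorem theorem4:
  fixes f :: "real \<Rightarrow> real" and n :: nat and A :: "complex mat"
  assumes "standard_op_monotone f" and "hermitian_mat n A"
  shows "\<forall>\<rho>1 \<rho>2 (t::real). pd_density n \<rho>1 \<and> pd_density n \<rho>2 \<and> 0 \<le> t \<and> t \<le> 1 \<longrightarrow>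
           t * Re (qCov f \<rho>1 A A) + (1 - t) * Re (qCov f \<rho>2 A A)
             \<le> Re (qCov f (complex_of_real t \<cdot>\<^sub>m \<rho>1 + complex_of_real (1 - t) \<cdot>\<^sub>m \<rho>2) A A)"
proof (intro allI impI, elim conjE)
  fix \<rho>1 \<rho>2 and t :: real
  assume d: "pd_density n \<rho>1" "pd_density n \<rho>2" and t: "0 \<le> t" "t \<le> 1"
  let ?\<rho> = "complex_of_real t \<cdot>\<^sub>m \<rho>1 + complex_of_real (1 - t) \<cdot>\<^sub>m \<rho>2"
  have p: "posdef_mat n \<rho>1" "posdef_mat n \<rho>2" using d by (auto simp: pd_density_def)
  have pp: "posdef_mat n ?\<rho>" by (rule posdef_convex[OF p]) (use t in auto)
  have h: "hermitian_mat n \<rho>1" "hermitian_mat n \<rho>2" "hermitian_mat n ?\<rho>"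
    using p pp by (auto simp: posdef_mat_def)
  have c: "\<rho>1 \<in> carrier_mat n n" "\<rho>2 \<in> carrier_mat n n" "?\<rho> \<in> carrier_mat n n" and A: "A \<in> carrier_mat n n"
    using h assms(2) by (auto simp: hermitian_mat_def)
  have tr: "mtrace (?\<rho> * A) = complex_of_real t * mtrace (\<rho>1 * A) + complex_of_real (1 - t) * mtrace (\<rho>2 * A)"
    unfolding mtrace_mult[OF c(3) A] mtrace_mult[OF c(1) A] mtrace_mult[OF c(2) A]
    using c by (simp add: sum_distrib_left sum.distrib[symmetric] algebra_simps)
  have "t * Re (hs_inner A (Jf f \<rho>1 A)) + (1 - t) * Re (hs_inner A (Jf f \<rho>2 A)) \<le> Re (hs_inner A (Jf f ?\<rho> A))"
    by (rule hs_inner_Jf_concave[OF assms(1) A p]) (use t in auto)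
  moreover have "(Re (mtrace (?\<rho> * A)))\<^sup>2 \<le> t * (Re (mtrace (\<rho>1 * A)))\<^sup>2 + (1 - t) * (Re (mtrace (\<rho>2 * A)))\<^sup>2"
    unfolding tr using square_convex[of t "1 - t" "Re (mtrace (\<rho>1 * A))" "Re (mtrace (\<rho>2 * A))"] t by simp
  ultimately show "t * Re (qCov f \<rho>1 A A) + (1 - t) * Re (qCov f \<rho>2 A A) \<le> Re (qCov f ?\<rho> A A)"
    unfolding Re_qCov_hermitian[OF assms(2) h(1)] Re_qCov_hermitian[OF assms(2) h(2)] Re_qCov_hermitian[OF assms(2) h(3)]
    by (simp only: right_diff_distrib)
qed

end
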